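(* Let $D=3$ and $p>2$, let $B_p$ be the bi-pyramidal bubble with $4p$ vertices and $\Omega^p$ its pairing given by the color-$3$ edges. Then $(B_p,\Omega^p)$ satisfies the cut-bubble property: for every set of bubbles $\mathbb{B}$ containing $B_p$ and every choice of pairings $\Omega_{B}$ of the bubbles $B\in\mathbb{B}$ with $\Omega_{B_p}=\Omega^p$, if $\Gamma$ is maximal in $\mathbb{S}(\mathbb{B},\Omega_{\mathbb{B}})$, then every submap $\Psi(B_p,\Omega^p)$ of $\Gamma$ is a cut-bubble, i.e. all color-$0$ edges incident to it are bridges.
   Context: A bubble ($D=3$) is a finite connected bipartite (black/white) $3$-regular graph properly edge-colored with colors $1,2,3$. The bi-pyramidal bubble $B_p$ is the graph dual to the boundary of the bi-pyramid over a $2p$-gon: two cycles of length $2p$, with vertices $u_1,\dots,u_{2p}$ and $w_1,\dots,w_{2p}$, whose edges $u_ku_{k+1}$ and $w_kw_{k+1}$ both have color $1$ for $k$ odd and $2$ for $k$ even (indices mod $2p$), together with color-$3$ edges $u_kw_k$. The pairing $\Omega^p$ consists of the pairs $\{u_k,w_k\}$. A pairing of a bubble is a partition of its vertices into black–white pairs. Stacked map: an object with white vertices, colored vertices and colored edges; an edge of color $c$ joins a white vertex and a color-$c$ vertex; each white vertex is incident to exactly one edge of each color (no ordering); color-$c$ vertices are incident only to color-$c$ edges, which are cyclically ordered. $\Psi(B,\Omega_B)$ is the stacked map with colors $1,2,3$ with one white vertex per pair of $\Omega_B$ and, for each color $i$ and each cycle of the permutation $\sigma_i$ of the pairs ($\sigma_i(\pi)=\pi'$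 if the color-$i$ edge at the black vertex of $\pi$ ends at the white vertex of $\pi'$), a color-$i$ vertex joined to the pairs of the cycle in this (counterclockwise) cyclic order. $\mathbb{S}(\mathbb{B},\Omega_{\mathbb{B}})$ is the set of finite connected stacked maps with colors $0,1,2,3$ such that deleting color-$0$ vertices and edges leaves a disjoint union of copies of the $\Psi(B,\Omega_B)$, $B\in\mathbb{B}$ (the bubbles of $\Gamma$). For such $\Gamma$, $\Gamma^{(i)}$ is the ordinary combinatorial map formed by all white vertices and the vertices and edges of colors $0$ and $i$, $F$ denotes its number of faces, and $\Phi_0(\Gamma)=\sum_{i=1}^3F(\Gamma^{(i)})$. $\Gamma$ is maximal if $\Phi_0(\Gamma)$ is the largest among elements of $\mathbb{S}(\mathbb{B},\Omega_{\mathbb{B}})$ with the same number of bubbles of each type. A color-$0$ edge is a bridge if it is a bridge of the graph obtained from $\Gamma$ by contracting each bubble to a single vertex (equivalently, detaching it from its color-$0$ endpoint and attaching it to a new color-$0$ vertex increases the number of connected components). *)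

theory Defs
  imports
    "HOL-Library.Disjoint_Sets"
    "HOL-Combinatorics.Orbits"
begin

section \<open>Connectivity in multigraphs\<close>

text \<open>A multigraph is given by a set of edges together with two maps sending each edge to its
  two endpoints. Two vertices are joined if there is a (possibly empty) path between them.\<close>

definition joined :: "'e set \<Rightarrow> ('e \<Rightarrow> 'v) \<Rightarrow> ('e \<Rightarrow> 'v) \<Rightarrow> ('v \<times> 'v) set" where
  "joined E s t = (((\<lambda>e. (s e, t e)) ` E) \<union> ((\<lambda>e. (t e, s e)) ` E))\<^sup>*"

definition is_bridge :: "'e set \<Rightarrow> ('e \<Rightarrow> 'v) \<Rightarrow> ('e \<Rightarrow> 'v) \<Rightarrow> 'e \<Rightarrow> bool" where
  "is_bridge E s t e \<longleftrightarrow> e \<in> E \<and> (s e, t e) \<notin> joined (E - {e}) s t"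


section \<open>Bubbles and pairings\<close>

text \<open>An edge \<open>(b, i, w)\<close> has color \<open>i\<close>, black endpoint \<open>b\<close> and white endpoint \<open>w\<close>. Properness of
  the coloring forbids parallel edges of the same color, so a set of triples represents all
  properly edge-colored bipartite multigraphs.\<close>

record 'v bubble =
  black :: "'v set"
  white :: "'v set"
  bedges :: "('v \<times> nat \<times> 'v) set"

definition incident :: "'v \<times> nat \<times> 'v \<Rightarrow> 'v \<Rightarrow> bool" where
  "incident e v \<longleftrightarrow> v = fst e \<or> v = snd (snd e)"

definition bcolor :: "'v \<times> nat \<times> 'v \<Rightarrow> nat" where
  "bcolor e = fst (snd e)"

definition is_bubble :: "'v bubble \<Rightarrow> bool" where
  "is_bubble B \<longleftrightarrow>
     finite (black B) \<and> finite (white B) \<and> black B \<union> white B \<noteq> {} \<and>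
     black B \<inter> white B = {} \<and>
     bedges B \<subseteq> black B \<times> {1, 2, 3} \<times> white B \<and>
     (\<forall>v \<in> black B \<union> white B. card {e \<in> bedges B. incident e v} = 3) \<and>
     (\<forall>e \<in> bedges B. \<forall>e' \<in> bedges B. \<forall>v.
        e \<noteq> e' \<and> incident e v \<and> incident e' v \<longrightarrow> bcolor e \<noteq> bcolor e') \<and>
     (\<forall>v \<in> black B \<union> white B. \<forall>v' \<in> black B \<union> white B.
        (v, v') \<in> joined (bedges B) fst (\<lambda>e. snd (snd e)))"

definition is_pairing :: "'v bubble \<Rightarrow> 'v set set \<Rightarrow> bool" where
  "is_pairing B \<Omega> \<longleftrightarrow>
     partition_on (black B \<union> white B) \<Omega> \<and>
     (\<forall>\<pi> \<in> \<Omega>. \<exists>b \<in> black B. \<exists>w \<in> white B. \<pi> = {b, w})"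

definition pair_perm :: "'v bubble \<Rightarrow> 'v set set \<Rightarrow> nat \<Rightarrow> 'v set \<Rightarrow> 'v set" where
  "pair_perm B \<Omega> i \<pi> =
     (THE \<pi>'. \<pi>' \<in> \<Omega> \<and> (\<exists>b \<in> \<pi>. \<exists>w \<in> \<pi>'. (b, i, w) \<in> bedges B))"


section \<open>Stacked maps\<close>

text \<open>\<open>rot\<close> maps an edge to the next one, counterclockwise, around its colored endpoint.
  Edges carry the color of their colored endpoint, which expresses both that an edge of color \<open>c\<close>
  has an endpoint of color \<open>c\<close> and that a colored vertex only meets edges of its own color.\<close>

record ('w, 'x, 'e) stacked_map =
  wverts :: "'w set"
  cverts :: "'x set"
  vcolor :: "'x \<Rightarrow> nat"
  edges :: "'e set"
  wend :: "'e \<Rightarrow> 'w"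
  cend :: "'e \<Rightarrow> 'x"
  rot :: "'e \<Rightarrow> 'e"

definition ecolor :: "('w, 'x, 'e) stacked_map \<Rightarrow> 'e \<Rightarrow> nat" where
  "ecolor M e = vcolor M (cend M e)"

definition is_stacked_map :: "nat set \<Rightarrow> ('w, 'x, 'e) stacked_map \<Rightarrow> bool" where
  "is_stacked_map C M \<longleftrightarrow>
     (\<forall>x \<in> cverts M. vcolor M x \<in> C) \<and>
     (\<forall>e \<in> edges M. wend M e \<in> wverts M \<and> cend M e \<in> cverts M) \<and>
     (\<forall>w \<in> wverts M. \<forall>c \<in> C. \<exists>!e. e \<in> edges M \<and> wend M e = w \<and> ecolor M e = c) \<and>
     (\<forall>x \<in> cverts M. {e \<in> edges M. cend M e = x} = {} \<or>
        cyclic_on (rot M) {e \<in> edges M. cend M e = x})"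

definition finite_map :: "('w, 'x, 'e) stacked_map \<Rightarrow> bool" where
  "finite_map M \<longleftrightarrow> finite (wverts M) \<and> finite (cverts M) \<and> finite (edges M)"

definition verts :: "('w, 'x, 'e) stacked_map \<Rightarrow> ('w + 'x) set" where
  "verts M = Inl ` wverts M \<union> Inr ` cverts M"

definition map_joined :: "('w, 'x, 'e) stacked_map \<Rightarrow> (('w + 'x) \<times> ('w + 'x)) set" where
  "map_joined M = joined (edges M) (\<lambda>e. Inl (wend M e)) (\<lambda>e. Inr (cend M e))"

definition connected_map :: "('w, 'x, 'e) stacked_map \<Rightarrow> bool" where
  "connected_map M \<longleftrightarrow>
     verts M \<noteq> {} \<and> (\<forall>a \<in> verts M. \<forall>b \<in> verts M. (a, b) \<in> map_joined M)"

definition components :: "('w, 'x, 'e) stacked_map \<Rightarrow> ('w + 'x) set set" where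
  "components M = verts M // map_joined M"

definition induced_map ::
  "('w, 'x, 'e) stacked_map \<Rightarrow> ('w + 'x) set \<Rightarrow> ('w, 'x, 'e) stacked_map" where
  "induced_map M S = M
     \<lparr> wverts := {w \<in> wverts M. Inl w \<in> S},
       cverts := {x \<in> cverts M. Inr x \<in> S},
       edges := {e \<in> edges M. Inl (wend M e) \<in> S \<and> Inr (cend M e) \<in> S} \<rparr>"

definition isomorphic ::
  "('w, 'x, 'e) stacked_map \<Rightarrow> ('w2, 'x2, 'e2) stacked_map \<Rightarrow> bool" where
  "isomorphic M N \<longleftrightarrow> (\<exists>f g h.
     bij_betw f (wverts M) (wverts N) \<and>
     bij_betw g (cverts M) (cverts N) \<and>
     bij_betw h (edges M) (edges N) \<and>
     (\<forall>x \<in> cverts M. vcolor N (g x) = vcolor M x) \<and>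
     (\<forall>e \<in> edges M. wend N (h e) = f (wend M e) \<and> cend N (h e) = g (cend M e) \<and>
        rot N (h e) = h (rot M e)))"

text \<open>The map \<open>\<Psi>(B, \<Omega>)\<close>: a colored vertex is a cycle of one of the permutations of the pairs,
  tagged with its color, and \<open>(\<pi>, i)\<close> is the edge of color \<open>i\<close> at the pair \<open>\<pi>\<close>.\<close>

definition Psi ::
  "'v bubble \<Rightarrow> 'v set set \<Rightarrow> ('v set, nat \<times> 'v set set, 'v set \<times> nat) stacked_map" where
  "Psi B \<Omega> =
     \<lparr> wverts = \<Omega>,
       cverts = {(i, orbit (pair_perm B \<Omega> i) \<pi>) | i \<pi>. i \<in> {1, 2, 3} \<and> \<pi> \<in> \<Omega>},
       vcolor = fst,
       edges = \<Omega> \<times> {1, 2, 3},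
       wend = fst,
       cend = (\<lambda>(\<pi>, i). (i, orbit (pair_perm B \<Omega> i) \<pi>)),
       rot = (\<lambda>(\<pi>, i). (pair_perm B \<Omega> i \<pi>, i)) \<rparr>"


section \<open>Stacked maps built from a set of bubbles\<close>

definition delete_0 :: "('w, 'x, 'e) stacked_map \<Rightarrow> ('w, 'x, 'e) stacked_map" where
  "delete_0 M = M
     \<lparr> cverts := {x \<in> cverts M. vcolor M x \<noteq> 0},
       edges := {e \<in> edges M. ecolor M e \<noteq> 0} \<rparr>"

text \<open>For a bubble \<open>B\<close>, \<open>Psi B \<Omega>\<close> is connected, so that being a disjoint union of copies of
  such maps means that all connected components are such copies.\<close>

definition bubbles_of :: "('w, 'x, 'e) stacked_map \<Rightarrow> ('w + 'x) set set" where
  "bubbles_of M = components (delete_0 M)"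

definition is_copy ::
  "('w, 'x, 'e) stacked_map \<Rightarrow> ('w + 'x) set \<Rightarrow> 'v bubble \<Rightarrow> 'v set set \<Rightarrow> bool" where
  "is_copy M S B \<Omega> \<longleftrightarrow> isomorphic (induced_map (delete_0 M) S) (Psi B \<Omega>)"

definition stacked_maps_over ::
  "'v bubble set \<Rightarrow> ('v bubble \<Rightarrow> 'v set set) \<Rightarrow> ('w, 'x, 'e) stacked_map set" where
  "stacked_maps_over \<B> \<Omega> =
     {M. is_stacked_map {0, 1, 2, 3} M \<and> finite_map M \<and> connected_map M \<and>
         (\<forall>S \<in> bubbles_of M. \<exists>B \<in> \<B>. is_copy M S B (\<Omega> B))}"

definition num_bubbles ::
  "('w, 'x, 'e) stacked_map \<Rightarrow> 'v bubble \<Rightarrow> 'v set set \<Rightarrow> nat" where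
  "num_bubbles M B \<Omega> = card {S \<in> bubbles_of M. is_copy M S B \<Omega>}"


section \<open>Faces and maximality\<close>

text \<open>An ordinary combinatorial map: darts (half-edges), the permutation of the darts rotating
  around the vertices, and the involution exchanging the two halves of each edge.\<close>

record 'd combinatorial_map =
  darts :: "'d set"
  vertex_perm :: "'d \<Rightarrow> 'd"
  edge_inv :: "'d \<Rightarrow> 'd"

definition faces :: "'d combinatorial_map \<Rightarrow> 'd set set" where
  "faces G = (\<lambda>d. orbit (vertex_perm G \<circ> edge_inv G) d) ` darts G"

text \<open>The dart \<open>(e, True)\<close> is the half of \<open>e\<close> at its white endpoint, \<open>(e, False)\<close> the half at its
  colored endpoint. In the map of colors \<open>0\<close> and \<open>i\<close> every white vertex is bivalent.\<close>

definition color_map ::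
  "('w, 'x, 'e) stacked_map \<Rightarrow> nat \<Rightarrow> ('e \<times> bool) combinatorial_map" where
  "color_map M i =
     (let E = {e \<in> edges M. ecolor M e \<in> {0, i}} in
      \<lparr> darts = E \<times> UNIV,
        vertex_perm = (\<lambda>(e, at_white).
          if at_white then (THE e'. e' \<in> E \<and> e' \<noteq> e \<and> wend M e' = wend M e, True)
          else (rot M e, False)),
        edge_inv = (\<lambda>(e, at_white). (e, \<not> at_white)) \<rparr>)"

definition Phi_0 :: "('w, 'x, 'e) stacked_map \<Rightarrow> nat" where
  "Phi_0 M = (\<Sum>i \<in> {1, 2, 3}. card (faces (color_map M i)))"

definition maximal ::
  "'v bubble set \<Rightarrow> ('v bubble \<Rightarrow> 'v set set) \<Rightarrow> ('w, 'x, 'e) stacked_map \<Rightarrow> bool" where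
  "maximal \<B> \<Omega> M \<longleftrightarrow>
     M \<in> stacked_maps_over \<B> \<Omega> \<and>
     (\<forall>M' :: ('w, 'x, 'e) stacked_map. M' \<in> stacked_maps_over \<B> \<Omega> \<and>
        (\<forall>B \<in> \<B>. num_bubbles M' B (\<Omega> B) = num_bubbles M B (\<Omega> B)) \<longrightarrow> Phi_0 M' \<le> Phi_0 M)"


section \<open>Cut-bubbles\<close>

text \<open>The graph obtained by contracting each bubble has the bubbles and the vertices of color \<open>0\<close>
  as vertices and the edges of color \<open>0\<close> as edges.\<close>

definition bubble_at :: "('w, 'x, 'e) stacked_map \<Rightarrow> 'w \<Rightarrow> ('w + 'x) set" where
  "bubble_at M w = map_joined (delete_0 M) `` {Inl w}"

definition bridge_0 :: "('w, 'x, 'e) stacked_map \<Rightarrow> 'e \<Rightarrow> bool" where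
  "bridge_0 M e \<longleftrightarrow>
     is_bridge {e \<in> edges M. ecolor M e = 0}
       (\<lambda>e. Inl (bubble_at M (wend M e))) (\<lambda>e. Inr (cend M e)) e"

definition cut_bubble :: "('w, 'x, 'e) stacked_map \<Rightarrow> ('w + 'x) set \<Rightarrow> bool" where
  "cut_bubble M S \<longleftrightarrow>
     (\<forall>e \<in> edges M. ecolor M e = 0 \<and> Inl (wend M e) \<in> S \<longrightarrow> bridge_0 M e)"

text \<open>Bubbles and stacked maps being finite, the countably infinite types \<^typ>\<open>nat + nat\<close> (for the
  vertices of bubbles) and \<^typ>\<open>nat\<close> (for the vertices and edges of stacked maps) contain all of
  them up to isomorphism.\<close>

definition cut_bubble_property :: "(nat + nat) bubble \<Rightarrow> (nat + nat) set set \<Rightarrow> bool" where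
  "cut_bubble_property B\<^sub>0 \<Omega>\<^sub>0 \<longleftrightarrow>
     (\<forall>(\<B> :: (nat + nat) bubble set) \<Omega> (M :: (nat, nat, nat) stacked_map).
        B\<^sub>0 \<in> \<B> \<and> (\<forall>B \<in> \<B>. is_bubble B \<and> is_pairing B (\<Omega> B)) \<and> \<Omega> B\<^sub>0 = \<Omega>\<^sub>0 \<and>
        maximal \<B> \<Omega> M \<longrightarrow>
        (\<forall>S \<in> bubbles_of M. is_copy M S B\<^sub>0 \<Omega>\<^sub>0 \<longrightarrow> cut_bubble M S))"


section \<open>The bi-pyramidal bubbles\<close>

text \<open>\<open>Inl k\<close> and \<open>Inr k\<close> are the vertices \<open>u\<^sub>k\<close> and \<open>w\<^sub>k\<close> of the two cycles, for
  \<open>1 \<le> k \<le> 2 * p\<close>. The graph has exactly two bipartite colorings, exchanged by the automorphism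
  swapping \<open>u\<^sub>k\<close> and \<open>w\<^sub>k\<close>; the one where \<open>u\<^sub>1\<close> is black is chosen.\<close>

definition cyc_next :: "nat \<Rightarrow> nat \<Rightarrow> nat" where
  "cyc_next p k = (if k = 2 * p then 1 else k + 1)"

definition bipyramid :: "nat \<Rightarrow> (nat + nat) bubble" where
  "bipyramid p =
     (let K = {1..2 * p};
          Bl = {Inl k | k. k \<in> K \<and> odd k} \<union> {Inr k | k. k \<in> K \<and> even k};
          Wh = {Inl k | k. k \<in> K \<and> even k} \<union> {Inr k | k. k \<in> K \<and> odd k}
      in \<lparr> black = Bl, white = Wh,
           bedges = {(b, i, w). b \<in> Bl \<and> w \<in> Wh \<and>
             (\<exists>k \<in> K.
                i = (if odd k then 1 else 2) \<and>
                  ({b, w} = {Inl k, Inl (cyc_next p k)} \<or> {b, w} = {Inr k, Inr (cyc_next p k)}) \<or>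
                i = 3 \<and> {b, w} = {Inl k, Inr k})} \<rparr>)"

definition bipyramid_pairing :: "nat \<Rightarrow> (nat + nat) set set" where
  "bipyramid_pairing p = {{Inl k, Inr k} | k. k \<in> {1..2 * p}}"

end

theory Submission
  imports Defs
begin

text \<open>Detaching a color-0 edge from its color-0 endpoint multiplies, for each color, the face
  permutation by a transposition of darts, so that each of the three numbers of faces changes by at
  most one. At a white vertex carrying a leaf of color 3 the number of faces of color 3 increases,
  and if the neighbor along a bivalent vertex of color 1 or 2 carries a leaf of color 0, then a
  second number increases as well, for a net gain. Detaching a bridge gains exactly three faces, as
  many as reattaching an edge can lose, so that a bridge at the neighbor serves as well as a leaf.
  Hence in a maximal map the color-0 edges of a copy of the bi-pyramidal bubble are all bridges or
  all non-bridges. In the latter case detaching any edge loses at most one face in total, and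
  detaching then an edge next to a bridge gains at least one, which yields another maximal map. In
  it the first edge is a bridge, but not all of the \<open>2 * p > 4\<close> edges are: if every edge is
  linked to another one outside the bubble, two detachments leave some linked pair intact.\<close>

section \<open>Orbits and transpositions\<close>

text \<open>\<open>orbit\<close> contains its base point only if iteration returns there, and
  \<open>f\<close> is controlled only on \<open>D\<close>. Extended by the identity outside
  \<open>D\<close>, it becomes a permutation with finite support, which has the same orbits on
  \<open>D\<close>.\<close>

lemma self_in_orbit_of_bij_betw:
  assumes "finite D" "bij_betw f D D" "x \<in> D"
  shows "x \<in> orbit f x"
proof -
  have "perm_restrict f D permutes D"
    using assms(2) by (intro bij_imp_permutes) (auto simp: perm_restrict_simps cong: bij_betw_cong)
  then have "x \<in> orbit (perm_restrict f D) x"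
    using assms(1) by (intro permutation_self_in_orbit) (auto simp: permutation_permutes)
  also have "orbit (perm_restrict f D) x = orbit f x"
    using assms by (intro orbit_cong0[of _ D]) (auto simp: perm_restrict_simps bij_betw_def)
  finally show ?thesis .
qed

lemma orbit_subset_closed:
  assumes "x \<in> A" "\<And>y. y \<in> A \<Longrightarrow> f y \<in> A"
  shows "orbit f x \<subseteq> A"
proof
  fix y assume "y \<in> orbit f x"
  then show "y \<in> A" by induct (auto simp: assms)
qed

lemma orbit_eq_of_mem:
  assumes "x \<in> orbit f x" "y \<in> orbit f x"
  shows "orbit f y = orbit f x"
  using assms by (meson orbit_swap orbit_trans subsetI subset_antisym)

text \<open>If \<open>x\<close> and \<open>y\<close> lie on one cycle of \<open>f\<close>,
  exchanging the two values never leaves that cycle, so every cycle of \<open>f\<close> is closed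
  under \<open>g\<close>.\<close>

lemma orbit_transposed_subset:
  assumes "finite D" "bij_betw f D D" "x \<in> D" "y \<in> D" "g x = f y" "g y = f x"
    "\<And>z. z \<in> D \<Longrightarrow> z \<noteq> x \<Longrightarrow> z \<noteq> y \<Longrightarrow> g z = f z"
    "y \<in> orbit f x" "z \<in> D"
  shows "orbit g z \<subseteq> orbit f z"
proof (rule orbit_subset_closed)
  have self: "u \<in> orbit f u" if "u \<in> D" for u
    using assms(1,2) that by (rule self_in_orbit_of_bij_betw)
  show "z \<in> orbit f z" using self assms(9) .
  fix u assume u: "u \<in> orbit f z"
  have "orbit f z \<subseteq> D"
    using assms(2,9) by (intro orbit_subset_closed) (auto simp: bij_betw_def)
  then have uD: "u \<in> D" using u by auto
  have eq: "orbit f u = orbit f z" using self[OF assms(9)] u by (rule orbit_eq_of_mem)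
  have xy: "orbit f y = orbit f x" using self[OF assms(3)] assms(8) by (rule orbit_eq_of_mem)
  consider "u = x" | "u = y" | "u \<noteq> x" "u \<noteq> y" by blast
  then show "g u \<in> orbit f z"
  proof cases
    case 1
    then have "g u \<in> orbit f y" using assms(5) by (simp add: orbit.base)
    then show ?thesis using xy eq 1 by simp
  next
    case 2
    then have "g u \<in> orbit f x" using assms(6) by (simp add: orbit.base)
    then show ?thesis using xy eq 2 by simp
  next
    case 3
    then show ?thesis using assms(7)[OF uD] u by (simp add: orbit.step)
  qed
qed

text \<open>Composition with a transposition glues the cycles of \<open>x\<close> and
  \<open>y\<close>, here distinct for \<open>f\<close>, into a single cycle of \<open>g\<close> and
  keeps all other cycles.\<close>

lemma card_orbits_merge:
  assumes D: "finite D" and f: "bij_betw f D D" and g: "bij_betw g D D"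
    and xy: "x \<in> D" "y \<in> D" and gx: "g x = f y" and gy: "g y = f x"
    and gz: "\<And>z. z \<in> D \<Longrightarrow> z \<noteq> x \<Longrightarrow> z \<noteq> y \<Longrightarrow> g z = f z"
    and ny: "y \<notin> orbit f x"
  shows "card (orbit f ` D) = Suc (card (orbit g ` D))"
proof -
  have selff: "u \<in> orbit f u" if "u \<in> D" for u
    using D f that by (rule self_in_orbit_of_bij_betw)
  have selfg: "u \<in> orbit g u" if "u \<in> D" for u
    using D g that by (rule self_in_orbit_of_bij_betw)
  have fD: "orbit f u \<subseteq> D" if "u \<in> D" for u
    using f that by (intro orbit_subset_closed) (auto simp: bij_betw_def)
  have nx: "x \<notin> orbit f y"
    using ny orbit_swap[OF selff[OF xy(2)]] by blast
  \<comment> \<open>From \<open>x\<close>, the map \<open>g\<close> enters the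
    \<open>f\<close>-cycle of \<open>y\<close> at \<open>f y\<close> and then follows it. This cycle
    avoids \<open>x\<close>, and after \<open>y\<close> comes the entry point again.\<close>
  have "u \<in> orbit g x" if "u \<in> orbit f y" for u
    using that
  proof induct
    case base
    then show ?case using orbit.base[of g x] gx by simp
  next
    case (step u)
    have "u \<in> D" using step(1) fD xy by blast
    moreover have "u \<noteq> x" using step(1) nx by auto
    ultimately show ?case
      using gz[of u] orbit.step[OF step(2)] orbit.base[of g x] gx by (cases "u = y") auto
  qed
  then have yg: "y \<in> orbit g x" using selff[OF xy(2)] by blast
  \<comment> \<open>Now \<open>y\<close> is on the \<open>g\<close>-cycle of \<open>x\<close>, so
    the inclusion lemma applies with the roles of \<open>f\<close> and \<open>g\<close>
    exchanged.\<close>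
  have sub: "orbit f z \<subseteq> orbit g z" if "z \<in> D" for z
    using D g xy _ _ _ yg that
    by (rule orbit_transposed_subset) (use gx gy gz in auto)
  let ?X = "orbit f x" and ?Y = "orbit f y"
  have 1: "orbit g z = orbit f z" if "z \<in> D" "z \<notin> ?X \<union> ?Y" for z
  proof
    have av: "x \<notin> orbit f z" "y \<notin> orbit f z"
      using that orbit_swap[OF selff[OF that(1)]] by blast+
    show "orbit g z \<subseteq> orbit f z"
    proof (rule orbit_subset_closed)
      fix u assume "u \<in> orbit f z"
      then show "g u \<in> orbit f z"
        using gz[of u] fD[OF that(1)] av orbit.step[of u f z] by (metis subsetD)
    qed (rule selff[OF that(1)])
  qed (rule sub[OF that(1)])
  have gxy: "orbit g y = orbit g x" using selfg[OF xy(1)] yg by (rule orbit_eq_of_mem)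
  have 2: "orbit g z = ?X \<union> ?Y" if "z \<in> ?X \<union> ?Y" for z
  proof
    show "orbit g z \<subseteq> ?X \<union> ?Y"
    proof (rule orbit_subset_closed[OF that])
      fix u assume u: "u \<in> ?X \<union> ?Y"
      then have "u \<in> D" using fD xy by auto
      then show "g u \<in> ?X \<union> ?Y"
        using u gx gy gz[of u] orbit.base[of f x] orbit.base[of f y]
        by (metis UnCI UnE orbit.step)
    qed
    have "z \<in> orbit g x"
      using that sub[OF xy(1)] sub[OF xy(2)] gxy by auto
    then have "orbit g z = orbit g x" using selfg[OF xy(1)] by (intro orbit_eq_of_mem)
    then show "?X \<union> ?Y \<subseteq> orbit g z" using sub[OF xy(1)] sub[OF xy(2)] gxy by auto
  qed
  have orb: "orbit f z = ?X" if "z \<in> ?X" for z using selff[OF xy(1)] that by (rule orbit_eq_of_mem)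
  have orb': "orbit f z = ?Y" if "z \<in> ?Y" for z using selff[OF xy(2)] that by (rule orbit_eq_of_mem)
  \<comment> \<open>These are the cycles common to \<open>f\<close> and \<open>g\<close>. Besides
    them, \<open>f\<close> has the two cycles \<open>?X\<close> and \<open>?Y\<close>, and
    \<open>g\<close> has only their union.\<close>
  let ?F = "orbit f ` D - {?X, ?Y}"
  have fim: "orbit f ` D = insert ?X (insert ?Y ?F)" using xy by auto
  have gim: "orbit g ` D = insert (?X \<union> ?Y) ?F"
  proof (intro set_eqI iffI)
    fix A assume "A \<in> orbit g ` D"
    then obtain z where z: "z \<in> D" "A = orbit g z" by auto
    show "A \<in> insert (?X \<union> ?Y) ?F"
    proof (cases "z \<in> ?X \<union> ?Y")
      case True then show ?thesis using 2 z by auto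
    next
      case False
      then have "orbit f z \<noteq> ?X" "orbit f z \<noteq> ?Y" using selff[OF z(1)] by auto
      then show ?thesis using 1[OF z(1) False] z by auto
    qed
  next
    fix A assume "A \<in> insert (?X \<union> ?Y) ?F"
    then consider "A = ?X \<union> ?Y" | z where "z \<in> D" "A = orbit f z" "A \<noteq> ?X" "A \<noteq> ?Y" by auto
    then show "A \<in> orbit g ` D"
    proof cases
      case 1
      then have "A = orbit g x" using 2[of x] selff[OF xy(1)] by simp
      then show ?thesis using xy by blast
    next
      case (2 z)
      have "z \<notin> ?X \<union> ?Y" using 2(2-4) orb[of z] orb'[of z] by blast
      with 2(1) have "orbit g z = A" unfolding 2(2) by (rule 1)
      then show ?thesis using 2(1) by blast
    qed
  qed
  have ne: "?X \<noteq> ?Y" using ny selff[OF xy(2)] by auto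
  have "?X \<union> ?Y \<notin> ?F"
  proof
    assume "?X \<union> ?Y \<in> ?F"
    then obtain z where z: "z \<in> D" "orbit f z = ?X \<union> ?Y" by auto
    have "x \<in> orbit f z" using z selff[OF xy(1)] by auto
    then have "?X = orbit f z" using selff[OF z(1)] by (intro orbit_eq_of_mem)
    then show False using z ny selff[OF xy(2)] by auto
  qed
  moreover have "finite ?F" using D by auto
  ultimately have "card (insert (?X \<union> ?Y) ?F) = Suc (card ?F)"
    "card (insert ?X (insert ?Y ?F)) = Suc (Suc (card ?F))"
    using ne by auto
  then show "card (orbit f ` D) = Suc (card (orbit g ` D))"
    using fim gim by argo
qed

text \<open>The second claim is the merging lemma read backwards, from \<open>g\<close> to
  \<open>f\<close>. It is phrased by the cycles of \<open>g\<close> because separation will be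
  visible after the detachment, not before it.\<close>

lemma card_orbits_transposed:
  assumes "finite D" "bij_betw f D D" "bij_betw g D D"
    "x \<in> D" "y \<in> D" "g x = f y" "g y = f x"
    "\<And>z. z \<in> D \<Longrightarrow> z \<noteq> x \<Longrightarrow> z \<noteq> y \<Longrightarrow> g z = f z"
  shows "card (orbit g ` D) \<le> Suc (card (orbit f ` D))"
    and "y \<notin> orbit g x \<Longrightarrow> card (orbit g ` D) = Suc (card (orbit f ` D))"
proof -
  show eq: "card (orbit g ` D) = Suc (card (orbit f ` D))" if "y \<notin> orbit g x"
    using assms that by (intro card_orbits_merge[of D g f x y]) auto
  show "card (orbit g ` D) \<le> Suc (card (orbit f ` D))"
  proof (cases "y \<in> orbit g x \<and> y \<in> orbit f x")
    case False
    then show ?thesis using eq card_orbits_merge[OF assms] by fastforce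
  next
    case True
    \<comment> \<open>This case includes \<open>x = y\<close>. The two inclusions make all orbits
      coincide, so it need not be decided whether distinct points can occur here.\<close>
    have "orbit g z = orbit f z" if "z \<in> D" for z
    proof
      show "orbit g z \<subseteq> orbit f z"
        by (rule orbit_transposed_subset[OF assms(1,2,4-8) _ that]) (use True in auto)
      show "orbit f z \<subseteq> orbit g z"
        by (rule orbit_transposed_subset[OF assms(1,3,4,5) _ _ _ _ that])
           (use True assms in auto)
    qed
    then have "orbit g ` D = orbit f ` D" by (rule image_cong[OF refl])
    then show ?thesis by simp
  qed
qed

section \<open>Faces of a stacked map\<close>

lemma cyclic_on_inj_on:
  assumes "cyclic_on f S"
  shows "inj_on f S"
proof (rule eq_card_imp_inj_on)
  show fin: "finite S" using assms by (rule finite_cyclic_on)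
  have "f ` S = S"
  proof
    show "f ` S \<subseteq> S" using cyclic_on_inI[OF assms] by auto
    obtain s where s: "s \<in> S" "S = orbit f s" using assms by (auto simp: cyclic_on_def)
    show "S \<subseteq> f ` S"
    proof
      fix y assume "y \<in> S"
      then have "y \<in> orbit f s" using s by simp
      then show "y \<in> f ` S" by cases (use s in auto)
    qed
  qed
  then show "card (f ` S) = card S" by simp
qed

text \<open>Connectivity is left out on purpose: the face counts below are also applied to maps that
  fall apart after a bridge has been detached.\<close>

locale finite_stacked_map =
  fixes M :: "('w, 'x, 'e) stacked_map"
  assumes stacked: "is_stacked_map {0, 1, 2, 3} M" and fin: "finite_map M"
begin

lemma vcolor_range: "x \<in> cverts M \<Longrightarrow> vcolor M x \<in> {0, 1, 2, 3}"
  using stacked by (auto simp: is_stacked_map_def)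

lemma endpoints: "e \<in> edges M \<Longrightarrow> wend M e \<in> wverts M" "e \<in> edges M \<Longrightarrow> cend M e \<in> cverts M"
  using stacked by (auto simp: is_stacked_map_def)

lemma ecolor_range: "e \<in> edges M \<Longrightarrow> ecolor M e \<in> {0, 1, 2, 3}"
  using vcolor_range endpoints by (simp add: ecolor_def)

lemma edge_unique:
  assumes "e \<in> edges M" "e' \<in> edges M" "wend M e = wend M e'" "ecolor M e = ecolor M e'"
  shows "e = e'"
proof -
  have "\<forall>w \<in> wverts M. \<forall>c \<in> {0, 1, 2, 3}. \<exists>!e. e \<in> edges M \<and> wend M e = w \<and> ecolor M e = c"
    using stacked unfolding is_stacked_map_def by blast
  then have "\<exists>!d. d \<in> edges M \<and> wend M d = wend M e \<and> ecolor M d = ecolor M e"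
    using endpoints(1)[OF assms(1)] ecolor_range[OF assms(1)] by blast
  then show ?thesis using assms by metis
qed

lemma edge_exists:
  assumes "w \<in> wverts M" "c \<in> {0, 1, 2, 3}"
  shows "\<exists>e \<in> edges M. wend M e = w \<and> ecolor M e = c"
proof -
  have "\<forall>w \<in> wverts M. \<forall>c \<in> {0, 1, 2, 3}. \<exists>!e. e \<in> edges M \<and> wend M e = w \<and> ecolor M e = c"
    using stacked unfolding is_stacked_map_def by blast
  then show ?thesis using assms by blast
qed

lemma cyclic_star:
  assumes "e \<in> edges M"
  shows "cyclic_on (rot M) {d \<in> edges M. cend M d = cend M e}"
  using stacked endpoints(2)[OF assms] assms by (auto simp: is_stacked_map_def)

lemma rot_closed:
  assumes "e \<in> edges M"
  shows "rot M e \<in> edges M" "cend M (rot M e) = cend M e" "ecolor M (rot M e) = ecolor M e"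
  using cyclic_on_inI[OF cyclic_star[OF assms], of e] assms by (auto simp: ecolor_def)

lemma rot_inj:
  assumes "e \<in> edges M" "e' \<in> edges M" "rot M e = rot M e'"
  shows "e = e'"
proof -
  have "cend M e' = cend M e" using assms rot_closed(2) by metis
  then show ?thesis
    using cyclic_on_inj_on[OF cyclic_star[OF assms(1)]] assms by (auto dest: inj_onD)
qed

lemma rot_surj:
  assumes "e \<in> edges M"
  obtains f where "f \<in> edges M" "rot M f = e" "cend M f = cend M e" "ecolor M f = ecolor M e"
proof -
  have "inj_on (rot M) (edges M)" using rot_inj by (auto intro: inj_onI)
  moreover have "finite (edges M)" using fin by (simp add: finite_map_def)
  ultimately have "rot M ` edges M = edges M"
    using rot_closed(1) by (intro endo_inj_surj) auto
  with assms have "e \<in> rot M ` edges M" by simp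
  then obtain f where f: "f \<in> edges M" "rot M f = e" by (elim imageE) simp
  then show ?thesis using that[OF f] rot_closed[OF f(1)] by simp
qed

end

section \<open>Face counts through an explicit permutation of darts\<close>

definition color_edges :: "('w, 'x, 'e) stacked_map \<Rightarrow> nat \<Rightarrow> 'e set" where
  "color_edges M i = {e \<in> edges M. ecolor M e \<in> {0, i}}"

definition mate :: "('w, 'x, 'e) stacked_map \<Rightarrow> nat \<Rightarrow> 'e \<Rightarrow> 'e" where
  "mate M i e = (THE e'. e' \<in> color_edges M i \<and> e' \<noteq> e \<and> wend M e' = wend M e)"

text \<open>This is \<open>vertex_perm\<close> composed with \<open>edge_inv\<close> for
  \<open>color_map M i\<close>, written out on darts. The rotation \<open>rot\<close> enters only at
  darts \<open>(e, True)\<close>, so a change of \<open>rot\<close> at two edges alters the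
  permutation at two darts.\<close>

definition face_perm :: "('w, 'x, 'e) stacked_map \<Rightarrow> nat \<Rightarrow> 'e \<times> bool \<Rightarrow> 'e \<times> bool" where
  "face_perm M i = (\<lambda>(e, at_white). if at_white then (rot M e, False) else (mate M i e, True))"

definition num_faces :: "('w, 'x, 'e) stacked_map \<Rightarrow> nat \<Rightarrow> nat" where
  "num_faces M i = card (orbit (face_perm M i) ` (color_edges M i \<times> UNIV))"

lemma num_faces_eq: "card (faces (color_map M i)) = num_faces M i"
proof -
  have "vertex_perm (color_map M i) \<circ> edge_inv (color_map M i) = face_perm M i"
    by (auto simp: color_map_def face_perm_def Let_def mate_def color_edges_def fun_eq_iff)
  then show ?thesis
    by (simp add: faces_def num_faces_def) (simp add: color_map_def Let_def color_edges_def)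
qed

lemma Phi_0_eq: "Phi_0 M = num_faces M 1 + num_faces M 2 + num_faces M 3"
  by (simp add: Phi_0_def num_faces_eq)

context finite_stacked_map
begin

lemma mate_eqI:
  assumes "i \<in> {1, 2, 3}" "e \<in> color_edges M i" "d \<in> color_edges M i" "d \<noteq> e" "wend M d = wend M e"
  shows "mate M i e = d"
  unfolding mate_def
proof (rule the_equality)
  fix d' assume d': "d' \<in> color_edges M i \<and> d' \<noteq> e \<and> wend M d' = wend M e"
  show "d' = d"
  proof (rule edge_unique)
    have "ecolor M d' \<noteq> ecolor M e" "ecolor M d \<noteq> ecolor M e"
      using edge_unique[of d' e] edge_unique[of d e] d' assms by (auto simp: color_edges_def)
    then show "ecolor M d' = ecolor M d" using d' assms by (auto simp: color_edges_def)
  qed (use d' assms in \<open>auto simp: color_edges_def\<close>)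
qed (use assms in auto)

lemma mate_works:
  assumes "i \<in> {1, 2, 3}" "e \<in> color_edges M i"
  shows "mate M i e \<in> color_edges M i" "mate M i e \<noteq> e" "wend M (mate M i e) = wend M e"
    "mate M i (mate M i e) = e"
proof -
  \<comment> \<open>As the color of \<open>e\<close> is \<open>0\<close> or \<open>i\<close>, the
    difference \<open>i - ecolor M e\<close> is the other of the two colors.\<close>
  obtain d where d: "d \<in> edges M" "wend M d = wend M e" "ecolor M d = i - ecolor M e"
    using edge_exists[of "wend M e" "i - ecolor M e"] endpoints(1)[of e] assms
    by (auto simp: color_edges_def)
  have *: "d \<in> color_edges M i" "d \<noteq> e" using d assms by (auto simp: color_edges_def)
  have "mate M i e = d" using mate_eqI[OF assms * d(2)] .
  moreover have "mate M i d = e" using mate_eqI[OF assms(1) *(1) assms(2)] * d by auto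
  ultimately show "mate M i e \<in> color_edges M i" "mate M i e \<noteq> e" "wend M (mate M i e) = wend M e"
    "mate M i (mate M i e) = e" using * d by auto
qed

lemma finite_darts: "finite (color_edges M i \<times> (UNIV :: bool set))"
  using fin by (simp add: finite_map_def color_edges_def)

lemma face_perm_bij:
  assumes "i \<in> {1, 2, 3}"
  shows "bij_betw (face_perm M i) (color_edges M i \<times> UNIV) (color_edges M i \<times> UNIV)"
proof -
  let ?D = "color_edges M i \<times> (UNIV :: bool set)"
  have "face_perm M i ` ?D \<subseteq> ?D"
  proof safe
    fix d b d' b' assume "d' \<in> color_edges M i" "(d, b) = face_perm M i (d', b')"
    then show "d \<in> color_edges M i"
      using mate_works(1)[OF assms, of d'] rot_closed[of d']
      by (cases b') (simp_all add: face_perm_def color_edges_def)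
  qed auto
  moreover have "inj_on (face_perm M i) ?D"
  proof (rule inj_onI)
    fix u v assume uv: "u \<in> ?D" "v \<in> ?D" "face_perm M i u = face_perm M i v"
    obtain d b d' b' where [simp]: "u = (d, b)" "v = (d', b')" by (cases u, cases v)
    have "mate M i d = mate M i d' \<Longrightarrow> d = d'"
      using mate_works(4)[OF assms] uv by (metis SigmaE2 \<open>u = _\<close> \<open>v = _\<close>)
    moreover have "rot M d = rot M d' \<Longrightarrow> d = d'"
      using rot_inj uv by (auto simp: color_edges_def)
    ultimately show "u = v" using uv(3) by (auto simp: face_perm_def split: if_splits)
  qed
  ultimately show ?thesis using finite_darts by (simp add: bij_betw_def endo_inj_surj)
qed

end

section \<open>Detaching an edge\<close>

text \<open>\<open>x\<close> is meant to be a fresh vertex and \<open>e\<close> a color-0 edge. The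
  predecessor of \<open>e\<close> in the rotation is redirected to the successor of
  \<open>e\<close>. The restriction to \<open>edges M\<close> leaves alone the arbitrary values of
  \<open>rot\<close> elsewhere, and the old endpoint of \<open>e\<close> remains a vertex even if no
  edge is left at it.\<close>

definition unhook ::
  "('w, 'x, 'e) stacked_map \<Rightarrow> 'x \<Rightarrow> 'e \<Rightarrow> ('w, 'x, 'e) stacked_map" where
  "unhook M x e = M
     \<lparr> cverts := insert x (cverts M),
       vcolor := (vcolor M)(x := 0),
       cend := (cend M)(e := x),
       rot := (\<lambda>d. if d = e then e else if d \<in> edges M \<and> rot M d = e then rot M e else rot M d) \<rparr>"

lemma unhook_simps [simp]:
  "wverts (unhook M x e) = wverts M"
  "cverts (unhook M x e) = insert x (cverts M)"
  "vcolor (unhook M x e) = (vcolor M)(x := 0)"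
  "edges (unhook M x e) = edges M"
  "wend (unhook M x e) = wend M"
  "cend (unhook M x e) = (cend M)(e := x)"
  by (simp_all add: unhook_def)

lemma rot_unhook:
  "rot (unhook M x e) d =
     (if d = e then e else if d \<in> edges M \<and> rot M d = e then rot M e else rot M d)"
  by (simp add: unhook_def)

locale detached_edge = finite_stacked_map M for M :: "('w, 'x, 'e) stacked_map" +
  fixes x :: 'x and e :: 'e
  assumes e: "e \<in> edges M" "ecolor M e = 0" and x: "x \<notin> cverts M"
begin

abbreviation "M' \<equiv> unhook M x e"

lemma ecolor_unhook: "d \<in> edges M \<Longrightarrow> ecolor M' d = ecolor M d"
  using x endpoints(2)[of d] e(2) by (auto simp: ecolor_def)

lemma rot_unhook_same_color:
  assumes "d \<in> edges M" "ecolor M d \<noteq> 0"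
  shows "rot M' d = rot M d"
  using assms e rot_closed(3)[OF assms(1)] by (auto simp: rot_unhook)

lemma color_edges_unhook: "color_edges M' i = color_edges M i"
  using ecolor_unhook by (auto simp: color_edges_def)

lemma mate_unhook: "mate M' i = mate M i"
  by (simp add: mate_def color_edges_unhook fun_eq_iff)

lemma cyclic_star_unhook:
  assumes "d \<in> edges M"
  shows "cyclic_on (rot M') {d' \<in> edges M. cend M' d' = cend M' d}"
proof -
  have ne: "cend M d' \<noteq> x" if "d' \<in> edges M" for d' using endpoints(2)[OF that] x by auto
  consider "d = e" | "d \<noteq> e" "cend M d \<noteq> cend M e" | "d \<noteq> e" "cend M d = cend M e" by blast
  then show ?thesis
  proof cases
    case 1
    have "{d' \<in> edges M. cend M' d' = cend M' d} = {e}" using ne e 1 by auto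
    moreover have "orbit (rot M') e = {e}" by (simp add: orbit_eq_singleton_iff rot_unhook)
    ultimately show ?thesis by (auto simp: cyclic_on_def)
  next
    case 2
    let ?A = "{d' \<in> edges M. cend M d' = cend M d}"
    have *: "{d' \<in> edges M. cend M' d' = cend M' d} = ?A" using 2 ne[OF assms] by auto
    have "rot M' d' = rot M d'" if "d' \<in> ?A" for d'
      using that 2 rot_closed[of d'] by (auto simp: rot_unhook)
    then show ?thesis
      using cyclic_star[OF assms] cyclic_cong[of ?A "rot M'" "rot M"] unfolding * by blast
  next
    case 3
    let ?A = "{d' \<in> edges M. cend M d' = cend M e}"
    have *: "{d' \<in> edges M. cend M' d' = cend M' d} = ?A - {e}"
      using 3 ne[OF assms] by auto
    have dA: "d \<in> ?A - {e}" using assms 3 by auto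
    have orb: "orbit (rot M) d' = ?A" if "d' \<in> ?A" for d'
      using cyclic_star[OF e(1)] that by (rule orbit_cyclic_eq3)
    have re: "rot M e \<noteq> e"
    proof
      assume "rot M e = e"
      then have "orbit (rot M) e = {e}" by (simp add: orbit_eq_singleton_iff)
      then show False using orb[of e] e dA by auto
    qed
    have sub: "orbit (rot M') d \<subseteq> ?A - {e}"
    proof (rule orbit_subset_closed[OF dA])
      fix y assume y: "y \<in> ?A - {e}"
      then show "rot M' y \<in> ?A - {e}"
        using rot_closed[of y] rot_closed[of e] e re by (auto simp: rot_unhook)
    qed
    \<comment> \<open>The new rotation visits the old cycle in the same order, except that when the
      old walk stands at \<open>e\<close>, the new one is already at \<open>rot M e\<close>.\<close>
    have "if y = e then rot M e \<in> orbit (rot M') d else y \<in> orbit (rot M') d"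
      if "y \<in> orbit (rot M) d" for y
      using that
    proof induct
      case base
      have "rot M' d \<in> orbit (rot M') d" by (rule orbit.base)
      moreover have "rot M' d = (if rot M d = e then rot M e else rot M d)"
        using dA by (simp add: rot_unhook)
      ultimately show ?case by (cases "rot M d = e") simp_all
    next
      case (step y)
      show ?case
      proof (cases "y = e")
        case True
        then show ?thesis using step(2) re by simp
      next
        case False
        have "y \<in> edges M" using step(1) orb[of d] dA by auto
        moreover have "rot M' y \<in> orbit (rot M') d"
          using step(2) False by (simp add: orbit.step)
        moreover have "rot M' y = (if rot M y = e then rot M e else rot M y)"
          using False \<open>y \<in> edges M\<close> by (simp add: rot_unhook)
        ultimately show ?thesis by (cases "rot M y = e") simp_all
      qed
    qed
    then have "?A - {e} \<subseteq> orbit (rot M') d" using orb[of d] dA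
      by (metis (no_types, lifting) Diff_iff insertCI subsetI)
    then have "?A - {e} = orbit (rot M') d" using sub by blast
    then show ?thesis unfolding * using dA unfolding cyclic_on_def by blast
  qed
qed

sublocale unhook: finite_stacked_map M'
proof
  show "finite_map M'" using fin by (simp add: finite_map_def)
  have 1: "vcolor M' y \<in> {0, 1, 2, 3}" if "y \<in> cverts M'" for y
    using vcolor_range[of y] that by auto
  have 2: "wend M' d \<in> wverts M' \<and> cend M' d \<in> cverts M'" if "d \<in> edges M'" for d
    using endpoints[of d] that by auto
  have 3: "\<exists>!d. d \<in> edges M' \<and> wend M' d = w \<and> ecolor M' d = c"
    if w: "w \<in> wverts M'" and c: "c \<in> {0, 1, 2, 3}" for w c
  proof -
    obtain d where d: "d \<in> edges M" "wend M d = w" "ecolor M d = c"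
      using edge_exists[OF _ c, of w] w unfolding unhook_simps by blast
    show ?thesis
    proof (rule ex1I[of _ d])
      show "d \<in> edges M' \<and> wend M' d = w \<and> ecolor M' d = c" using d ecolor_unhook by simp
      show "d' = d" if "d' \<in> edges M' \<and> wend M' d' = w \<and> ecolor M' d' = c" for d'
        using that d ecolor_unhook[of d'] by (intro edge_unique) auto
    qed
  qed
  have 4: "{d \<in> edges M'. cend M' d = y} = {} \<or>
        cyclic_on (rot M') {d \<in> edges M'. cend M' d = y}" for y
  proof (rule disjCI)
    assume "\<not> cyclic_on (rot M') {d \<in> edges M'. cend M' d = y}"
    moreover have "cyclic_on (rot M') {d \<in> edges M'. cend M' d = y}"
      if "{d \<in> edges M'. cend M' d = y} \<noteq> {}"
    proof -
      from that obtain d where "d \<in> edges M" "cend M' d = y" by auto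
      then show ?thesis using cyclic_star_unhook[of d] by auto
    qed
    ultimately show "{d \<in> edges M'. cend M' d = y} = {}" by blast
  qed
  show "is_stacked_map {0, 1, 2, 3} M'"
    unfolding is_stacked_map_def 
  proof (intro conjI ballI)
    fix y assume "y \<in> cverts M'" then show "vcolor M' y \<in> {0, 1, 2, 3}" by (rule 1)
  next
    fix d assume "d \<in> edges M'" then show "wend M' d \<in> wverts M'" using 2 by blast
  next
    fix d assume "d \<in> edges M'" then show "cend M' d \<in> cverts M'" using 2 by blast
  next
    fix w c assume "w \<in> wverts M'" "c \<in> {0, 1, 2, 3 :: nat}"
    then show "\<exists>!d. d \<in> edges M' \<and> wend M' d = w \<and> ecolor M' d = c" by (rule 3)
  next
    fix y show "{d \<in> edges M'. cend M' d = y} = {} \<or>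
        cyclic_on (rot M') {d \<in> edges M'. cend M' d = y}" by (rule 4)
  qed
qed

lemma rot_unhook_free:
  assumes "rot M e = e"
  shows "rot M' = rot M"
  using assms rot_inj[OF _ e(1)] by (auto simp: rot_unhook fun_eq_iff)

lemma num_faces_unhook_free:
  assumes "rot M e = e"
  shows "num_faces M' i = num_faces M i"
proof -
  have "face_perm M' i = face_perm M i"
    unfolding face_perm_def mate_unhook rot_unhook_free[OF assms] ..
  then show ?thesis by (simp add: num_faces_def color_edges_unhook)
qed

text \<open>With \<open>f\<close> the predecessor of \<open>e\<close>, the new face permutation
  takes at \<open>(e, True)\<close> and \<open>(f, True)\<close> the exchanged old values and agrees
  with the old one elsewhere. If the two darts lie on different faces after the detachment, a face
  has been split.\<close>

lemma num_faces_unhook: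
  assumes i: "i \<in> {1, 2, 3}" and "f \<in> edges M" "rot M f = e" "f \<noteq> e"
  shows "num_faces M' i \<le> Suc (num_faces M i)" "num_faces M i \<le> Suc (num_faces M' i)"
    "(f, True) \<notin> orbit (face_perm M' i) (e, True) \<Longrightarrow> num_faces M' i = Suc (num_faces M i)"
proof -
  let ?D = "color_edges M i \<times> (UNIV :: bool set)"
  have fc: "ecolor M f = 0" using rot_closed(3)[of f] assms e by simp
  have D: "(e, True) \<in> ?D" "(f, True) \<in> ?D" using e assms fc by (auto simp: color_edges_def)
  have bij': "bij_betw (face_perm M' i) ?D ?D"
    using unhook.face_perm_bij[OF i] by (simp add: color_edges_unhook)
  have v: "face_perm M' i (e, True) = face_perm M i (f, True)"
     "face_perm M' i (f, True) = face_perm M i (e, True)"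
    using assms by (auto simp: face_perm_def rot_unhook)
  have vz: "face_perm M' i z = face_perm M i z" if "z \<in> ?D" "z \<noteq> (e, True)" "z \<noteq> (f, True)" for z
  proof -
    obtain d b where [simp]: "z = (d, b)" by (cases z)
    have "rot M d = e \<Longrightarrow> d = f" using that rot_inj[of d f] assms by (auto simp: color_edges_def)
    then show ?thesis using that by (cases b) (auto simp: face_perm_def rot_unhook mate_unhook)
  qed
  note T = card_orbits_transposed[OF finite_darts face_perm_bij[OF i] bij' D v vz]
  show "num_faces M' i \<le> Suc (num_faces M i)"
    "(f, True) \<notin> orbit (face_perm M' i) (e, True) \<Longrightarrow> num_faces M' i = Suc (num_faces M i)"
    using T by (simp_all add: num_faces_def color_edges_unhook)
  have "card (orbit (face_perm M i) ` ?D) \<le> Suc (card (orbit (face_perm M' i) ` ?D))"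
    by (rule card_orbits_transposed(1)[OF finite_darts bij' face_perm_bij[OF i] D]) (use v vz in auto)
  then show "num_faces M i \<le> Suc (num_faces M' i)"
    by (simp add: num_faces_def color_edges_unhook)
qed

lemma num_faces_unhook_le:
  assumes "i \<in> {1, 2, 3}"
  shows "num_faces M' i \<le> Suc (num_faces M i)" "num_faces M i \<le> Suc (num_faces M' i)"
proof -
  obtain f where "f \<in> edges M" "rot M f = e" using rot_surj[OF e(1)] by blast
  then have "num_faces M' i \<le> Suc (num_faces M i) \<and> num_faces M i \<le> Suc (num_faces M' i)"
    using num_faces_unhook[OF assms, of f] num_faces_unhook_free by (cases "f = e") auto
  then show "num_faces M' i \<le> Suc (num_faces M i)" "num_faces M i \<le> Suc (num_faces M' i)" by auto
qed

text \<open>A criterion for gaining a face: a set \<open>A\<close> closed under the new face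
  permutation contains the whole new face of \<open>(e, True)\<close>, and it separates this dart
  from the one of the predecessor of \<open>e\<close>.\<close>

lemma num_faces_unhook_closed:
  assumes i: "i \<in> {1, 2, 3}" and "rot M e \<noteq> e" and A: "(e, True) \<in> A"
    "\<And>d. d \<in> A \<Longrightarrow> face_perm M' i d \<in> A"
    "\<And>f. f \<in> edges M \<Longrightarrow> rot M f = e \<Longrightarrow> f \<noteq> e \<Longrightarrow> (f, True) \<notin> A"
  shows "num_faces M' i = Suc (num_faces M i)"
proof -
  obtain f where f: "f \<in> edges M" "rot M f = e" using rot_surj[OF e(1)] by blast
  have "f \<noteq> e" using f assms by auto
  moreover have "orbit (face_perm M' i) (e, True) \<subseteq> A" using A(1,2) by (rule orbit_subset_closed)
  ultimately show ?thesis using num_faces_unhook(3)[OF i f] A(3) f by blast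
qed

text \<open>After the detachment, \<open>e\<close> and \<open>a\<close> form a path with a leaf at
  both ends. This path is a whole component of the map of colors 0 and \<open>i\<close>, so its
  darts form a closed set.\<close>

lemma num_faces_unhook_leaf:
  assumes "i \<in> {1, 2, 3}" "rot M e \<noteq> e" and a: "a \<in> edges M" "ecolor M a = i" "wend M a = wend M e"
    "rot M a = a"
  shows "num_faces M' i = Suc (num_faces M i)"
proof (rule num_faces_unhook_closed[OF assms(1,2), where A = "{e, a} \<times> UNIV"])
  have "a \<in> color_edges M i" "e \<in> color_edges M i" "a \<noteq> e"
    using a e assms(1) by (auto simp: color_edges_def)
  then have "mate M i a = e" "mate M i e = a" using a assms(1) by (auto intro: mate_eqI)
  moreover have "rot M' e = e" "rot M' a = a"
    using a rot_unhook_same_color[of a] assms(1) by (auto simp: rot_unhook)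
  ultimately have "face_perm M' i (e, b) \<in> {e, a} \<times> UNIV" "face_perm M' i (a, b) \<in> {e, a} \<times> UNIV"
    for b by (simp_all add: face_perm_def mate_unhook)
  then show "face_perm M' i d \<in> {e, a} \<times> UNIV" if "d \<in> {e, a} \<times> UNIV" for d
    using that by blast
qed (use a in auto)

text \<open>The same argument for the longer path \<open>e\<close>, \<open>a\<close>,
  \<open>b\<close>, \<open>f\<close>: its inner colored vertex is bivalent, and after the detachment
  both of its ends are leaves.\<close>

lemma num_faces_unhook_next_to_free:
  assumes "i \<in> {1, 2, 3}" "rot M e \<noteq> e" and f: "f \<in> edges M" "ecolor M f = 0" "rot M f = f"
    and a: "a \<in> edges M" "ecolor M a = i" "wend M a = wend M e"
    and b: "b \<in> edges M" "ecolor M b = i" "wend M b = wend M f"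
    and ab: "rot M a = b" "rot M b = a"
  shows "num_faces M' i = Suc (num_faces M i)"
proof (rule num_faces_unhook_closed[OF assms(1,2), where A = "{e, f, a, b} \<times> UNIV"])
  have "a \<in> color_edges M i" "e \<in> color_edges M i" "a \<noteq> e" "b \<in> color_edges M i"
     "f \<in> color_edges M i" "b \<noteq> f"
    using a b e f assms(1) by (auto simp: color_edges_def)
  then have "mate M i a = e" "mate M i e = a" "mate M i b = f" "mate M i f = b"
    using a b assms(1) by (auto intro: mate_eqI)
  moreover have "rot M' e = e" "rot M' a = b" "rot M' b = a" "rot M' f = f"
    using a b ab f rot_unhook_same_color[of a] rot_unhook_same_color[of b] assms(1)
    by (auto simp: rot_unhook)
  ultimately have "face_perm M' i (d, c) \<in> {e, f, a, b} \<times> UNIV" if "d \<in> {e, f, a, b}" for d c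
    using that by (elim insertE) (simp_all add: face_perm_def mate_unhook)
  then show "face_perm M' i d \<in> {e, f, a, b} \<times> UNIV" if "d \<in> {e, f, a, b} \<times> UNIV" for d
    using that by blast
next
  show "(g, True) \<notin> {e, f, a, b} \<times> UNIV" if g: "g \<in> edges M" "rot M g = e" "g \<noteq> e" for g
  proof -
    have "ecolor M g = 0" using rot_closed(3)[OF g(1)] g(2) e(2) by metis
    then have "g \<noteq> a" "g \<noteq> b" using a(2) b(2) assms(1) by auto
    moreover have "g \<noteq> f" using f(3) g by metis
    ultimately show ?thesis using g(3) by blast
  qed
qed auto

end

section \<open>Bridges\<close>

lemma joined_refl: "(a, a) \<in> joined E s t"
  by (simp add: joined_def)

lemma joined_sym:
  assumes "(a, b) \<in> joined E s t"
  shows "(b, a) \<in> joined E s t"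
proof -
  have "sym (((\<lambda>e. (s e, t e)) ` E) \<union> ((\<lambda>e. (t e, s e)) ` E))" by (auto intro!: symI)
  then show ?thesis using assms unfolding joined_def by (meson sym_rtrancl symD)
qed

lemma joined_trans:
  "(a, b) \<in> joined E s t \<Longrightarrow> (b, c) \<in> joined E s t \<Longrightarrow> (a, c) \<in> joined E s t"
  unfolding joined_def by (rule rtrancl_trans)

lemma joined_edge:
  assumes "e \<in> E"
  shows "(s e, t e) \<in> joined E s t" "(t e, s e) \<in> joined E s t"
  using assms unfolding joined_def by auto

lemma joined_mono: "E \<subseteq> E' \<Longrightarrow> joined E s t \<subseteq> joined E' s t"
  unfolding joined_def by (intro rtrancl_mono) auto

lemma joined_cong:
  assumes "\<And>e. e \<in> E \<Longrightarrow> s e = s' e" "\<And>e. e \<in> E \<Longrightarrow> t e = t' e"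
  shows "joined E s t = joined E s' t'"
proof -
  have "(\<lambda>e. (s e, t e)) ` E = (\<lambda>e. (s' e, t' e)) ` E" "(\<lambda>e. (t e, s e)) ` E = (\<lambda>e. (t' e, s' e)) ` E"
    using assms by (auto intro!: image_cong)
  then show ?thesis unfolding joined_def by simp
qed

text \<open>The invariant principle behind all proofs of non-connection: a set that contains both or
  neither of the endpoints of each edge cannot be left.\<close>

lemma joined_closed:
  assumes "(a, b) \<in> joined E s t" "a \<in> A" "\<And>e. e \<in> E \<Longrightarrow> s e \<in> A \<longleftrightarrow> t e \<in> A"
  shows "b \<in> A"
  using assms(1,2) unfolding joined_def by (induct rule: rtrancl_induct) (use assms(3) in auto)

section \<open>The graph of color-0 edges with contracted bubbles\<close>

definition zero_edges :: "('w, 'x, 'e) stacked_map \<Rightarrow> 'e set" where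
  "zero_edges M = {e \<in> edges M. ecolor M e = 0}"

definition zero_joined ::
  "('w, 'x, 'e) stacked_map \<Rightarrow> 'e set \<Rightarrow> ((('w + 'x) set + 'x) \<times> (('w + 'x) set + 'x)) set" where
  "zero_joined M E = joined E (\<lambda>e. Inl (bubble_at M (wend M e))) (\<lambda>e. Inr (cend M e))"

definition hooks :: "('w, 'x, 'e) stacked_map \<Rightarrow> ('w + 'x) set \<Rightarrow> 'e set" where
  "hooks M S = {e \<in> zero_edges M. bubble_at M (wend M e) = S}"

text \<open>Connection outside the bubble: all color-0 edges at \<open>S\<close> are removed, and
  the relation compares color-0 endpoints. It groups the edges at \<open>S\<close> by the component
  they reach once the bubble is taken away.\<close>

definition linked :: "('w, 'x, 'e) stacked_map \<Rightarrow> ('w + 'x) set \<Rightarrow> 'e \<Rightarrow> 'e \<Rightarrow> bool" where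
  "linked M S d d' \<longleftrightarrow>
     (Inr (cend M d), Inr (cend M d')) \<in> zero_joined M (zero_edges M - hooks M S)"

lemma zero_joined_edge:
  assumes "e \<in> E"
  shows "(Inl (bubble_at M (wend M e)), Inr (cend M e)) \<in> zero_joined M E"
  using joined_edge(1)[OF assms, of "\<lambda>e. Inl (bubble_at M (wend M e))" "\<lambda>e. Inr (cend M e)"]
  by (simp add: zero_joined_def)

lemma linked_refl: "linked M S d d"
  by (simp add: linked_def zero_joined_def joined_refl)

lemma linked_sym: "linked M S d d' \<Longrightarrow> linked M S d' d"
  by (simp add: linked_def zero_joined_def joined_sym)

lemma linked_trans: "linked M S d d' \<Longrightarrow> linked M S d' d'' \<Longrightarrow> linked M S d d''"
  unfolding linked_def zero_joined_def by (rule joined_trans)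

lemma bridge_0_eq:
  "bridge_0 M e \<longleftrightarrow> e \<in> zero_edges M \<and>
     (Inl (bubble_at M (wend M e)), Inr (cend M e)) \<notin> zero_joined M (zero_edges M - {e})"
  by (simp add: bridge_0_def is_bridge_def zero_edges_def zero_joined_def)

text \<open>After its last visit to the bubble, a path witnessing that \<open>d\<close> is not a bridge leaves the
  bubble through some other edge \<open>d'\<close> and avoids the bubble from then on.\<close>

lemma bridge_0_iff:
  fixes M :: "('w, 'x, 'e) stacked_map"
  assumes d: "d \<in> hooks M S"
  shows "bridge_0 M d \<longleftrightarrow> (\<forall>d' \<in> hooks M S - {d}. \<not> linked M S d' d)"
proof -
  let ?J = "zero_joined M (zero_edges M - {d})" and ?K = "zero_joined M (zero_edges M - hooks M S)"
  have dS: "d \<in> zero_edges M" "bubble_at M (wend M d) = S" using d by (auto simp: hooks_def)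
  \<comment> \<open>The path argument is recast as an invariant: \<open>?A\<close> consists of
    \<open>S\<close> and of everything reachable, while avoiding \<open>S\<close>, from the endpoint
    of an edge of \<open>S\<close> other than \<open>d\<close>.\<close>
  let ?A = "{v. v = Inl S \<or> (\<exists>d' \<in> hooks M S - {d}. (Inr (cend M d'), v) \<in> ?K)}"
  have "\<exists>d' \<in> hooks M S - {d}. linked M S d' d" if "(Inl S, Inr (cend M d)) \<in> ?J"
  proof -
    have "Inr (cend M d) \<in> ?A"
    proof (rule joined_closed[OF that[unfolded zero_joined_def]])
      fix g assume g: "g \<in> zero_edges M - {d}"
      let ?s = "Inl (bubble_at M (wend M g)) :: ('w + 'x) set + 'x" and ?t = "Inr (cend M g) :: ('w + 'x) set + 'x"
      show "?s \<in> ?A \<longleftrightarrow> ?t \<in> ?A"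
      proof (cases "g \<in> hooks M S")
        case True
        then have "?s = Inl S" by (simp add: hooks_def)
        moreover have "(?t, ?t) \<in> ?K" by (simp add: zero_joined_def joined_refl)
        ultimately show ?thesis using True g by blast
      next
        case False
        then have "g \<in> zero_edges M - hooks M S" using g by blast
        then have "(?s, ?t) \<in> ?K" "(?t, ?s) \<in> ?K" unfolding zero_joined_def by (rule joined_edge)+
        moreover have "?s \<noteq> Inl S" using False g by (auto simp: hooks_def)
        ultimately show ?thesis unfolding zero_joined_def by (blast intro: joined_trans)
      qed
    qed simp
    then show ?thesis by (auto simp: linked_def)
  qed
  moreover have "(Inl S, Inr (cend M d)) \<in> ?J" if "d' \<in> hooks M S - {d}" "linked M S d' d" for d'
  proof -
    have "(Inr (cend M d'), Inr (cend M d)) \<in> ?J"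
      using that(2) d joined_mono[of "zero_edges M - hooks M S" "zero_edges M - {d}"]
      unfolding linked_def zero_joined_def by blast
    moreover have "(Inl (bubble_at M (wend M d')), Inr (cend M d')) \<in> ?J"
      using that(1) unfolding zero_joined_def by (intro joined_edge(1)) (auto simp: hooks_def)
    ultimately show ?thesis
      using that(1) unfolding zero_joined_def by (auto simp: hooks_def intro: joined_trans)
  qed
  ultimately show ?thesis using dS unfolding bridge_0_eq by blast
qed

lemma map_joined_edge:
  assumes "d \<in> edges M"
  shows "(Inl (wend M d), Inr (cend M d)) \<in> map_joined M"
  using joined_edge(1)[OF assms, of "\<lambda>e. Inl (wend M e)" "\<lambda>e. Inr (cend M e)"]
  by (simp add: map_joined_def)

lemma map_joined_sym: "(a, b) \<in> map_joined M \<Longrightarrow> (b, a) \<in> map_joined M"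
  unfolding map_joined_def by (rule joined_sym)

lemma map_joined_trans:
  "(a, b) \<in> map_joined M \<Longrightarrow> (b, c) \<in> map_joined M \<Longrightarrow> (a, c) \<in> map_joined M"
  unfolding map_joined_def by (rule joined_trans)

lemma bubble_at_self: "Inl w \<in> bubble_at M w"
  by (simp add: bubble_at_def map_joined_def joined_refl)

lemma bubble_at_eq:
  assumes "(Inl w, Inl w') \<in> map_joined (delete_0 M)"
  shows "bubble_at M w' = bubble_at M w"
  using assms unfolding bubble_at_def by (blast intro: map_joined_sym map_joined_trans)

context finite_stacked_map
begin

lemma bubble_at_rot:
  assumes "d \<in> edges M" "ecolor M d \<noteq> 0"
  shows "bubble_at M (wend M (rot M d)) = bubble_at M (wend M d)"
proof (rule bubble_at_eq)
  have "(Inl (wend M d), Inr (cend M d)) \<in> map_joined (delete_0 M)"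
    using map_joined_edge[of d "delete_0 M"] assms by (simp add: delete_0_def)
  moreover have "(Inl (wend M (rot M d)), Inr (cend M d)) \<in> map_joined (delete_0 M)"
    using map_joined_edge[of "rot M d" "delete_0 M"] assms rot_closed[OF assms(1)]
    by (simp add: delete_0_def)
  ultimately show "(Inl (wend M d), Inl (wend M (rot M d))) \<in> map_joined (delete_0 M)"
    by (blast intro: map_joined_sym map_joined_trans)
qed

text \<open>A fixed point of the rotation is alone at its color-0 vertex, and removing it isolates
  this vertex.\<close>

lemma bridge_if_free:
  assumes "e \<in> zero_edges M" "rot M e = e"
  shows "bridge_0 M e"
proof -
  have "orbit (rot M) e = {e}" using assms by (simp add: orbit_eq_singleton_iff)
  then have star: "d = e" if "d \<in> edges M" "cend M d = cend M e" for d
    using orbit_cyclic_eq3[OF cyclic_star, of e e] assms that by (auto simp: zero_edges_def)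
  have "Inr (cend M e) \<in> {v :: ('w + 'x) set + 'x. v \<noteq> Inr (cend M e)}"
    if "(Inl (bubble_at M (wend M e)), Inr (cend M e)) \<in> zero_joined M (zero_edges M - {e})"
    by (rule joined_closed[OF that[unfolded zero_joined_def]]) (use star in \<open>auto simp: zero_edges_def\<close>)
  then show ?thesis using assms by (auto simp: bridge_0_eq)
qed

end

section \<open>Effect of a detachment on bubbles, connectivity and bridges\<close>

context detached_edge
begin

lemma e_zero: "e \<in> zero_edges M"
  using e by (simp add: zero_edges_def)

lemma zero_edges_unhook: "zero_edges M' = zero_edges M"
  using ecolor_unhook by (auto simp: zero_edges_def)

lemma edges_delete_0_unhook: "edges (delete_0 M') = edges (delete_0 M)"
  using ecolor_unhook by (auto simp: delete_0_def)

lemma map_joined_delete_0_unhook: "map_joined (delete_0 M') = map_joined (delete_0 M)"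
  unfolding map_joined_def edges_delete_0_unhook
  by (rule joined_cong) (use e in \<open>auto simp: delete_0_def\<close>)

lemma bubble_at_unhook: "bubble_at M' = bubble_at M"
  by (simp add: bubble_at_def map_joined_delete_0_unhook fun_eq_iff)

lemma hooks_unhook: "hooks M' S = hooks M S"
  by (simp add: hooks_def zero_edges_unhook bubble_at_unhook)

lemma cverts_delete_0_unhook: "cverts (delete_0 M') = cverts (delete_0 M)"
  using x by (auto simp: delete_0_def)

lemma bubbles_of_unhook: "bubbles_of M' = bubbles_of M"
proof -
  have "verts (delete_0 M') = verts (delete_0 M)"
    unfolding verts_def cverts_delete_0_unhook by (simp add: delete_0_def)
  then show ?thesis by (simp add: bubbles_of_def components_def map_joined_delete_0_unhook)
qed

text \<open>Deleting color 0 forgets all that \<open>unhook\<close> changes on actual vertices and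
  edges. As records the two induced maps may differ, for instance in \<open>cend\<close> at
  \<open>e\<close>, but an isomorphism looks only at elements of the carriers.\<close>

lemma is_copy_unhook: "is_copy M' S B \<Omega> \<longleftrightarrow> is_copy M S B \<Omega>"
proof -
  let ?N = "induced_map (delete_0 M) S" and ?N' = "induced_map (delete_0 M') S"
  have w: "wverts ?N' = wverts ?N" by (simp add: induced_map_def delete_0_def)
  have c: "cverts ?N' = cverts ?N"
    using cverts_delete_0_unhook by (simp add: induced_map_def)
  have cd: "cend M' d = cend M d" if "d \<in> edges (delete_0 M)" for d
    using that e by (auto simp: delete_0_def)
  have "edges ?N' = {d \<in> edges (delete_0 M'). Inl (wend M' d) \<in> S \<and> Inr (cend M' d) \<in> S}"
    by (simp add: induced_map_def delete_0_def)
  also have "\<dots> = {d \<in> edges (delete_0 M). Inl (wend M d) \<in> S \<and> Inr (cend M d) \<in> S}"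
    unfolding edges_delete_0_unhook using cd by (intro Collect_cong) (metis unhook_simps(5))
  also have "\<dots> = edges ?N" by (simp add: induced_map_def delete_0_def)
  finally have ed: "edges ?N' = edges ?N" .
  have vc: "vcolor ?N' y = vcolor ?N y" if "y \<in> cverts ?N" for y
    using that x by (auto simp: induced_map_def delete_0_def)
  have "wend ?N' d = wend ?N d \<and> cend ?N' d = cend ?N d \<and> rot ?N' d = rot ?N d"
    if "d \<in> edges ?N" for d
  proof -
    have "d \<in> edges M" "ecolor M d \<noteq> 0" using that by (auto simp: induced_map_def delete_0_def)
    moreover from this have "d \<noteq> e" using e by auto
    ultimately show ?thesis
      using rot_unhook_same_color[of d] by (simp add: induced_map_def delete_0_def)
  qed
  then show ?thesis
    unfolding is_copy_def isomorphic_def w c ed using vc by (simp cong: ball_cong)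
qed

lemma num_bubbles_unhook: "num_bubbles M' B \<Omega> = num_bubbles M B \<Omega>"
  by (simp add: num_bubbles_def bubbles_of_unhook is_copy_unhook)

text \<open>For a non-bridge, the contracted graph has a path from the bubble of \<open>e\<close> to
  the old endpoint of \<open>e\<close> that avoids \<open>e\<close>. It lifts to the new map because
  bubbles are connected without color 0.\<close>

lemma connected_unhook:
  assumes "connected_map M" "\<not> bridge_0 M e"
  shows "connected_map M'"
proof -
  let ?w = "wend M e"
  have old: "(Inl (wend M d), Inr (cend M d)) \<in> map_joined M'" if "d \<in> edges M" "d \<noteq> e" for d
    using map_joined_edge[of d M'] that by simp
  have "map_joined (delete_0 M) \<subseteq> map_joined M'"
    unfolding map_joined_delete_0_unhook[symmetric] unfolding map_joined_def
    using joined_mono[of "edges (delete_0 M')" "edges M'"] by (auto simp: delete_0_def)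
  then have bub: "(Inl w, a) \<in> map_joined M'" if "a \<in> bubble_at M w" for a w
    using that by (auto simp: bubble_at_def)
  \<comment> \<open>The lift to the uncontracted map: a bubble counts as reached if all of its
    elements are reached from \<open>?w\<close>.\<close>
  let ?A = "{v. case v of Inl T \<Rightarrow> \<forall>a \<in> T. (Inl ?w, a) \<in> map_joined M'
                | Inr y \<Rightarrow> (Inl ?w, Inr y) \<in> map_joined M'}"
  have "(Inl (bubble_at M ?w), Inr (cend M e)) \<in> zero_joined M (zero_edges M - {e})"
    using assms(2) e_zero by (simp add: bridge_0_eq)
  then have "Inr (cend M e) \<in> ?A"
    unfolding zero_joined_def
  proof (rule joined_closed)
    show "Inl (bubble_at M ?w) \<in> ?A" using bub by simp
    fix g assume "g \<in> zero_edges M - {e}"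
    then have g: "(Inl (wend M g), Inr (cend M g)) \<in> map_joined M'"
      using old by (auto simp: zero_edges_def)
    have "(Inl ?w, a) \<in> map_joined M'" if "(Inl ?w, Inr (cend M g)) \<in> map_joined M'"
      "a \<in> bubble_at M (wend M g)" for a
      using that bub[OF that(2)] g by (meson map_joined_sym map_joined_trans)
    moreover have "(Inl ?w, Inr (cend M g)) \<in> map_joined M'"
      if "\<forall>a \<in> bubble_at M (wend M g). (Inl ?w, a) \<in> map_joined M'"
      using that bubble_at_self[of "wend M g" M] g by (meson map_joined_trans)
    ultimately show "Inl (bubble_at M (wend M g)) \<in> ?A \<longleftrightarrow> Inr (cend M g) \<in> ?A"
      unfolding mem_Collect_eq sum.case by blast
  qed
  then have ec: "(Inl ?w, Inr (cend M e)) \<in> map_joined M'" by simp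
  have sub: "b \<in> {b. (a, b) \<in> map_joined M'}" if "(a, b) \<in> map_joined M" for a b
    using that unfolding map_joined_def[of M]
  proof (rule joined_closed)
    show "a \<in> {b. (a, b) \<in> map_joined M'}" by (simp add: map_joined_def joined_refl)
    fix d assume "d \<in> edges M"
    then have "(Inl (wend M d), Inr (cend M d)) \<in> map_joined M'" using old ec by metis
    then show "Inl (wend M d) \<in> {b. (a, b) \<in> map_joined M'} \<longleftrightarrow>
      Inr (cend M d) \<in> {b. (a, b) \<in> map_joined M'}"
      by (blast intro: map_joined_sym map_joined_trans)
  qed
  have wv: "Inl ?w \<in> verts M" using endpoints(1)[OF e(1)] by (simp add: verts_def)
  have all: "(Inl ?w, b) \<in> map_joined M'" if "b \<in> verts M'" for b
  proof (cases "b = Inr x")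
    case True
    then show ?thesis using map_joined_edge[of e M'] e by simp
  next
    case False
    then have "b \<in> verts M" using that by (auto simp: verts_def)
    then show ?thesis using assms(1) wv sub unfolding connected_map_def by blast
  qed
  have "(a, b) \<in> map_joined M'" if "a \<in> verts M'" "b \<in> verts M'" for a b
    using all[OF that(1)] all[OF that(2)] by (blast intro: map_joined_sym map_joined_trans)
  then show ?thesis unfolding connected_map_def by (auto simp: verts_def)
qed

lemma stacked_maps_over_unhook:
  assumes "M \<in> stacked_maps_over \<B> \<Omega>" "\<not> bridge_0 M e"
  shows "M' \<in> stacked_maps_over \<B> \<Omega>"
  using assms connected_unhook unhook.stacked unhook.fin
  by (simp add: stacked_maps_over_def bubbles_of_unhook is_copy_unhook)

text \<open>Links are defined after removing all color-0 edges of \<open>S\<close>, among them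
  \<open>e\<close>, so moving an endpoint of \<open>e\<close> leaves the relevant graph
  unchanged.\<close>

lemma linked_unhook:
  assumes "e \<in> hooks M S" "d \<noteq> e" "d' \<noteq> e"
  shows "linked M' S d d' \<longleftrightarrow> linked M S d d'"
proof -
  have "zero_joined M' (zero_edges M - hooks M S) = zero_joined M (zero_edges M - hooks M S)"
    unfolding zero_joined_def bubble_at_unhook by (rule joined_cong) (use assms(1) in auto)
  then show ?thesis using assms by (simp add: linked_def zero_edges_unhook hooks_unhook)
qed

lemma not_linked_unhook:
  assumes "e \<in> hooks M S" "d \<in> edges M" "d \<noteq> e"
  shows "\<not> linked M' S e d"
proof
  assume "linked M' S e d"
  then have "(Inr x, Inr (cend M d)) \<in> zero_joined M' (zero_edges M - hooks M S)"
    using assms by (simp add: linked_def zero_edges_unhook hooks_unhook)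
  then have "Inr (cend M d) \<in> {Inr x :: ('w + 'x) set + 'x}"
    unfolding zero_joined_def
  proof (rule joined_closed)
    fix g assume "g \<in> zero_edges M - hooks M S"
    then have "g \<noteq> e" "cend M g \<noteq> x" using assms(1) x endpoints(2) by (auto simp: zero_edges_def)
    then show "Inl (bubble_at M' (wend M' g)) \<in> {Inr x} \<longleftrightarrow> Inr (cend M' g) \<in> {Inr x}" by simp
  qed simp
  then show False using endpoints(2)[OF assms(2)] x by simp
qed

text \<open>The detached edge ends at an isolated vertex outside \<open>S\<close> and is linked to
  no other edge of \<open>S\<close>. Every other edge just loses \<open>e\<close> as a possible
  partner.\<close>

lemma bridge_unhook_iff:
  assumes "e \<in> hooks M S" "d \<in> hooks M S"
  shows "bridge_0 M' d \<longleftrightarrow> d = e \<or> (\<forall>d' \<in> hooks M S - {d, e}. \<not> linked M S d' d)"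
proof -
  have "d \<in> hooks M' S" using assms(2) by (simp add: hooks_unhook)
  then have *: "bridge_0 M' d \<longleftrightarrow> (\<forall>d' \<in> hooks M S - {d}. \<not> linked M' S d' d)"
    using bridge_0_iff[of d M' S] by (simp add: hooks_unhook)
  have ed: "d' \<in> edges M" if "d' \<in> hooks M S" for d'
    using that by (simp add: hooks_def zero_edges_def)
  show ?thesis
  proof (cases "d = e")
    case True
    then show ?thesis using * not_linked_unhook[OF assms(1) ed] by (metis Diff_iff insertCI linked_sym)
  next
    case False
    have "linked M' S d' d \<longleftrightarrow> d' \<noteq> e \<and> linked M S d' d" if "d' \<in> hooks M S - {d}" for d'
      using not_linked_unhook[OF assms(1) ed[OF assms(2)] False] linked_unhook[OF assms(1) _ False]
      by (cases "d' = e") auto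
    then show ?thesis using * False by auto
  qed
qed

text \<open>After the detachment no face passes between the two sides of the bridge: the darts on
  the side of the bubble of \<open>e\<close> form a closed set, while the predecessor of
  \<open>e\<close> lies on the other side.\<close>

lemma num_faces_unhook_bridge:
  assumes i: "i \<in> {1, 2, 3}" and "rot M e \<noteq> e" and br: "bridge_0 M e"
  shows "num_faces M' i = Suc (num_faces M i)"
proof -
  let ?J = "zero_joined M (zero_edges M - {e})"
  let ?b = "\<lambda>d. Inl (bubble_at M (wend M d)) :: ('w + 'x) set + 'x"
  have hook: "(?b d, Inr (cend M d)) \<in> ?J" if "d \<in> zero_edges M - {e}" for d
    using that by (rule zero_joined_edge)
  have J_trans: "(u, v) \<in> ?J \<Longrightarrow> (v, w) \<in> ?J \<Longrightarrow> (u, w) \<in> ?J" for u v w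
    unfolding zero_joined_def by (rule joined_trans)
  have J_sym: "(u, v) \<in> ?J \<Longrightarrow> (v, u) \<in> ?J" for u v
    unfolding zero_joined_def by (rule joined_sym)
  \<comment> \<open>The side of a dart is read off from the bubble at its white endpoint. Turning at
    a white vertex or at a vertex of color \<open>i\<close> stays in the bubble, and turning at a
    color-0 vertex uses edges other than \<open>e\<close>.\<close>
  let ?A = "{d \<in> color_edges M i. (?b e, ?b d) \<in> ?J} \<times> (UNIV :: bool set)"
  show ?thesis
  proof (rule num_faces_unhook_closed[OF i assms(2), where A = ?A])
    show "(e, True) \<in> ?A" using e by (simp add: color_edges_def zero_joined_def joined_refl)
  next
    fix z assume "z \<in> ?A"
    then obtain d b where z: "z = (d, b)" and d: "d \<in> color_edges M i" "(?b e, ?b d) \<in> ?J" by auto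
    have de: "d \<in> edges M" using d by (simp add: color_edges_def)
    show "face_perm M' i z \<in> ?A"
    proof (cases b)
      case False
      then show ?thesis
        using mate_works[OF i d(1)] d z by (simp add: face_perm_def mate_unhook)
    next
      case True
      consider "d = e" | "d \<noteq> e" "ecolor M d = 0" | "ecolor M d \<noteq> 0" by blast
      then have "rot M' d \<in> color_edges M i \<and> (?b e, ?b (rot M' d)) \<in> ?J"
      proof cases
        case 1
        then show ?thesis using d by (simp add: rot_unhook)
      next
        case 2
        then have "rot M' d \<noteq> e" using assms(2) de by (auto simp: rot_unhook)
        moreover have "rot M' d \<in> zero_edges M" "cend M (rot M' d) = cend M d"
          using 2 rot_closed[OF de] rot_closed[OF e(1)] de e
          by (auto simp: rot_unhook zero_edges_def)
        ultimately have "(?b (rot M' d), Inr (cend M d)) \<in> ?J" using hook[of "rot M' d"] by simp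
        moreover have "(?b d, Inr (cend M d)) \<in> ?J" using hook[of d] 2 de by (simp add: zero_edges_def)
        ultimately have "(?b e, ?b (rot M' d)) \<in> ?J" using d(2) J_sym J_trans by meson
        then show ?thesis using \<open>rot M' d \<in> zero_edges M\<close> by (simp add: color_edges_def zero_edges_def)
      next
        case 3
        then show ?thesis
          using rot_unhook_same_color[OF de] bubble_at_rot[OF de] rot_closed[OF de] d
          by (simp add: color_edges_def)
      qed
      then show ?thesis using True z by (simp add: face_perm_def)
    qed
  next
    fix f assume f: "f \<in> edges M" "rot M f = e" "f \<noteq> e"
    then have "f \<in> zero_edges M - {e}" using rot_closed(3)[OF f(1)] e by (simp add: zero_edges_def)
    then have "(?b f, Inr (cend M e)) \<in> ?J" using hook[of f] rot_closed(2)[OF f(1)] f(2) by simp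
    then show "(f, True) \<notin> ?A" using br J_trans by (auto simp: bridge_0_eq)
  qed
qed

end

section \<open>Pyramidal edges\<close>

text \<open>Neither edge follows the other in the rotation, so the two shortcuts do not
  interfere.\<close>

lemma unhook_commute:
  assumes "a \<noteq> b" "rot M a \<noteq> b" "rot M b \<noteq> a"
  shows "unhook (unhook M x a) y b = unhook (unhook M y b) x a"
  using assms unfolding unhook_def by (cases "x = y") (simp_all add: fun_eq_iff insert_commute)

text \<open>The white vertices \<open>wend M b\<close> and \<open>wend M a\<close> are consecutive on the cycle
  \<open>\<Psi>(B\<^sub>p, \<Omega>\<^sup>p)\<close>, whose vertices all carry a leaf of color 3.\<close>

definition pyramidal :: "('w, 'x, 'e) stacked_map \<Rightarrow> 'e \<Rightarrow> 'e \<Rightarrow> bool" where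
  "pyramidal M a b \<longleftrightarrow> (\<exists>l \<in> edges M. \<exists>d \<in> edges M. \<exists>d' \<in> edges M.
     ecolor M l = 3 \<and> wend M l = wend M b \<and> rot M l = l \<and>
     ecolor M d \<in> {1, 2} \<and> ecolor M d' = ecolor M d \<and> wend M d = wend M b \<and> wend M d' = wend M a \<and>
     rot M d = d' \<and> rot M d' = d)"

context detached_edge
begin

lemma pyramidal_unhook: "pyramidal M a b \<Longrightarrow> pyramidal M' a b"
  unfolding pyramidal_def
proof (elim bexE conjE)
  fix l d d' assume "l \<in> edges M" "d \<in> edges M" "d' \<in> edges M"
     "ecolor M l = 3" "wend M l = wend M b" "rot M l = l"
     "ecolor M d \<in> {1, 2}" "ecolor M d' = ecolor M d" "wend M d = wend M b" "wend M d' = wend M a"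
     "rot M d = d'" "rot M d' = d"
  then show "\<exists>l \<in> edges M'. \<exists>d \<in> edges M'. \<exists>d' \<in> edges M'.
     ecolor M' l = 3 \<and> wend M' l = wend M' b \<and> rot M' l = l \<and>
     ecolor M' d \<in> {1, 2} \<and> ecolor M' d' = ecolor M' d \<and> wend M' d = wend M' b \<and> wend M' d' = wend M' a \<and>
     rot M' d = d' \<and> rot M' d' = d"
    using ecolor_unhook[of l] ecolor_unhook[of d] ecolor_unhook[of d'] rot_unhook_same_color[of l]
      rot_unhook_same_color[of d] rot_unhook_same_color[of d']
    by (intro bexI[of _ l] bexI[of _ d] bexI[of _ d']) auto
qed

text \<open>Color 3 gains a face because of the leaf, while colors 1 and 2 lose at most one face
  each.\<close>

lemma Phi_0_unhook_ge:
  assumes "rot M e \<noteq> e" "pyramidal M a e"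
  shows "Phi_0 M \<le> Suc (Phi_0 M')"
proof -
  obtain l where l: "l \<in> edges M" "ecolor M l = 3" "wend M l = wend M e" "rot M l = l"
    using assms(2) unfolding pyramidal_def by blast
  have "num_faces M' 3 = Suc (num_faces M 3)"
    using assms(1) l by (intro num_faces_unhook_leaf) auto
  then show ?thesis
    using num_faces_unhook_le(2)[of 1] num_faces_unhook_le(2)[of 2] by (simp add: Phi_0_eq)
qed

text \<open>Color 3 and the color of the bivalent vertex both gain a face, and the remaining color
  loses at most one.\<close>

lemma Phi_0_unhook_next_to_free:
  assumes "rot M e \<noteq> e" "pyramidal M f e" "f \<in> zero_edges M" "rot M f = f"
  shows "Suc (Phi_0 M) \<le> Phi_0 M'"
proof -
  obtain l d d' where l: "l \<in> edges M" "ecolor M l = 3" "wend M l = wend M e" "rot M l = l"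
    and d: "d \<in> edges M" "wend M d = wend M e" "ecolor M d \<in> {1, 2}"
    and d': "d' \<in> edges M" "ecolor M d' = ecolor M d" "wend M d' = wend M f"
    and r: "rot M d = d'" "rot M d' = d"
    using assms(2) unfolding pyramidal_def by blast
  have 3: "num_faces M' 3 = Suc (num_faces M 3)"
    using assms(1) l by (intro num_faces_unhook_leaf) auto
  have "num_faces M' (ecolor M d) = Suc (num_faces M (ecolor M d))"
    by (rule num_faces_unhook_next_to_free[OF _ assms(1) _ _ assms(4) d(1) refl d(2) d' r])
      (use d(3) assms(3) in \<open>auto simp: zero_edges_def\<close>)
  moreover have "ecolor M d = 1 \<or> ecolor M d = 2" using d(3) by simp
  ultimately show ?thesis
    using 3 num_faces_unhook_le(2)[of 1] num_faces_unhook_le(2)[of 2]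
    by (elim disjE) (simp_all add: Phi_0_eq)
qed

end

text \<open>Unless \<open>a\<close> is already free, it is detached first, for a gain of exactly
  three faces. Then \<open>b\<close> has a free neighbor and gains at least one more. Since the
  detachments commute and reattaching \<open>a\<close> loses at most three faces, the gain of one
  remains for detaching \<open>b\<close> alone.\<close>

lemma Phi_0_unhook_next_to_bridge:
  assumes "finite_stacked_map M" and ab: "a \<in> hooks M S" "b \<in> hooks M S" "pyramidal M a b"
    and br: "bridge_0 M a" "\<not> bridge_0 M b"
    and xy: "x \<notin> cverts M" "y \<notin> cverts M" "x \<noteq> y"
  shows "Suc (Phi_0 M) \<le> Phi_0 (unhook M y b)"
proof -
  interpret finite_stacked_map M by fact
  have a: "a \<in> edges M" "ecolor M a = 0" and b: "b \<in> edges M" "ecolor M b = 0"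
    using ab by (auto simp: hooks_def zero_edges_def)
  interpret A: detached_edge M x a by unfold_locales (use a xy in auto)
  interpret B: detached_edge M y b by unfold_locales (use b xy in auto)
  have ne: "a \<noteq> b" using br by auto
  have rb: "rot M b \<noteq> b" using br(2) bridge_if_free[of b] b by (auto simp: zero_edges_def)
  show ?thesis
  proof (cases "rot M a = a")
    case True
    then show ?thesis using A.e_zero ab(3) rb by (intro B.Phi_0_unhook_next_to_free)
  next
    case False
    \<comment> \<open>Being a bridge, \<open>a\<close> is not linked to \<open>b\<close>. So the two
      edges end at different color-0 vertices and cannot follow each other in the rotation.\<close>
    have "\<not> linked M S b a" using br(1) bridge_0_iff[OF ab(1)] ab(2) ne by blast
    then have "cend M a \<noteq> cend M b" using linked_refl[of M S a] by (auto simp: linked_def)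
    then have r: "rot M a \<noteq> b" "rot M b \<noteq> a" using rot_closed(2) a(1) b(1) by metis+
    interpret AB: detached_edge "unhook M x a" y b
      by unfold_locales (use b xy A.ecolor_unhook[OF b(1)] in auto)
    interpret BA: detached_edge "unhook M y b" x a
      by unfold_locales (use a xy B.ecolor_unhook[OF a(1)] in auto)
    have "Phi_0 (unhook M x a) = Phi_0 M + 3"
      using A.num_faces_unhook_bridge[OF _ False br(1)] by (simp add: Phi_0_eq)
    moreover have "Suc (Phi_0 (unhook M x a)) \<le> Phi_0 (unhook (unhook M x a) y b)"
    proof (rule AB.Phi_0_unhook_next_to_free)
      show "rot (unhook M x a) b \<noteq> b" using rb r(2) ne by (simp add: rot_unhook)
      show "pyramidal (unhook M x a) a b" using ab(3) by (rule A.pyramidal_unhook)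
      show "a \<in> zero_edges (unhook M x a)" using A.e_zero by (simp add: A.zero_edges_unhook)
      show "rot (unhook M x a) a = a" by (simp add: rot_unhook)
    qed
    moreover have "unhook (unhook M x a) y b = unhook (unhook M y b) x a"
      using ne r by (rule unhook_commute)
    moreover have "Phi_0 (unhook (unhook M y b) x a) \<le> Phi_0 (unhook M y b) + 3"
      using BA.num_faces_unhook_le(1)[of 1] BA.num_faces_unhook_le(1)[of 2]
        BA.num_faces_unhook_le(1)[of 3] by (simp add: Phi_0_eq)
    ultimately show ?thesis by simp
  qed
qed

section \<open>Rings of bridges\<close>

lemma cyc_next_mem: "k \<in> {1..2 * p} \<Longrightarrow> cyc_next p k \<in> {1..2 * p}"
  by (auto simp: cyc_next_def)

lemma cyc_next_parity: "even (cyc_next p k) \<longleftrightarrow> odd k"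
  by (auto simp: cyc_next_def)

lemma cyc_next_inj:
  "k \<in> {1..2 * p} \<Longrightarrow> j \<in> {1..2 * p} \<Longrightarrow> cyc_next p k = cyc_next p j \<Longrightarrow> k = j"
  unfolding cyc_next_def by (cases "k = 2 * p"; cases "j = 2 * p") simp_all

text \<open>If \<open>P\<close> were preserved by every step, it would propagate up to
  \<open>2 * p\<close>, wrap around to 1, and from there reach every index.\<close>

lemma cyc_next_switch:
  assumes "k \<in> {1..2 * p}" "P k" "j \<in> {1..2 * p}" "\<not> P j"
  shows "\<exists>i \<in> {1..2 * p}. P i \<and> \<not> P (cyc_next p i)"
proof (rule ccontr)
  assume "\<not> ?thesis"
  then have step: "P (cyc_next p i)" if "i \<in> {1..2 * p}" "P i" for i using that by blast
  have up: "P m" if "n \<in> {1..2 * p}" "P n" "n \<le> m" "m \<le> 2 * p" for n m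
    using that(3,4)
  proof (induct m rule: dec_induct)
    case (step m)
    then show ?case using \<open>\<And>i. _ \<Longrightarrow> _ \<Longrightarrow> P (cyc_next p i)\<close>[of m] that(1) by (auto simp: cyc_next_def)
  qed (rule that(2))
  have "P (2 * p)" using up[OF assms(1,2)] assms(1) by auto
  then have "P 1" using step[of "2 * p"] assms(1) by (auto simp: cyc_next_def)
  then show False using up[of 1 j] assms by auto
qed

text \<open>Otherwise each element outside \<open>A\<close> has a partner in \<open>A\<close>. Two
  elements with the same partner would be related to each other, so choosing partners is injective
  and \<open>H - A\<close> is no larger than \<open>A\<close>.\<close>

lemma ex_pair_outside:
  assumes "finite H" "A \<subseteq> H" "2 * card A < card H"
    and sym: "\<And>d d'. R d d' \<Longrightarrow> R d' d" and trans: "\<And>d d' d''. R d d' \<Longrightarrow> R d' d'' \<Longrightarrow> R d d''"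
    and ex: "\<And>d. d \<in> H \<Longrightarrow> \<exists>d' \<in> H - {d}. R d' d"
  shows "\<exists>d \<in> H - A. \<exists>d' \<in> H - A - {d}. R d' d"
proof (rule ccontr)
  assume none: "\<not> ?thesis"
  have "\<forall>d \<in> H - A. \<exists>d' \<in> A. R d' d" using none ex by blast
  then obtain \<phi> where \<phi>: "\<And>d. d \<in> H - A \<Longrightarrow> \<phi> d \<in> A \<and> R (\<phi> d) d" by metis
  have "inj_on \<phi> (H - A)"
  proof (rule inj_onI)
    fix d d' assume d: "d \<in> H - A" "d' \<in> H - A" "\<phi> d = \<phi> d'"
    then have "R d' d" using \<phi>[OF d(1)] \<phi>[OF d(2)] sym trans by metis
    then show "d = d'" using none d by blast
  qed
  moreover have "\<phi> ` (H - A) \<subseteq> A" using \<phi> by blast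
  moreover have "finite A" using assms(1,2) by (rule finite_subset[rotated])
  ultimately have "card (H - A) \<le> card A" by (rule card_inj_on_le)
  then show False using assms(1-3) by (simp add: card_Diff_subset finite_subset)
qed

text \<open>\<open>h\<close> lists the color-0 edges at \<open>S\<close> along the cycle of white
  vertices of the bubble. Apart from \<open>h\<close> itself, the structure rests on edges of
  nonzero color and therefore survives detachments.\<close>

definition pyramidal_ring ::
  "nat \<Rightarrow> ('w, 'x, 'e) stacked_map \<Rightarrow> ('w + 'x) set \<Rightarrow> (nat \<Rightarrow> 'e) \<Rightarrow> bool" where
  "pyramidal_ring p M S h \<longleftrightarrow> hooks M S = h ` {1..2 * p} \<and> inj_on h {1..2 * p} \<and>
     (\<forall>k \<in> {1..2 * p}. pyramidal M (h k) (h (cyc_next p k)))"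

lemma (in detached_edge) pyramidal_ring_unhook:
  "pyramidal_ring p M S h \<Longrightarrow> pyramidal_ring p M' S h"
  using pyramidal_unhook by (simp add: pyramidal_ring_def hooks_unhook)

lemma pyramidal_ring_switch:
  assumes "pyramidal_ring p M S h" "d \<in> hooks M S" "bridge_0 M d" "d' \<in> hooks M S" "\<not> bridge_0 M d'"
  obtains a b where "a \<in> hooks M S" "b \<in> hooks M S" "pyramidal M a b" "bridge_0 M a" "\<not> bridge_0 M b"
proof -
  obtain k j where "k \<in> {1..2 * p}" "bridge_0 M (h k)" "j \<in> {1..2 * p}" "\<not> bridge_0 M (h j)"
    using assms by (auto simp: pyramidal_ring_def)
  then obtain i where "i \<in> {1..2 * p}" "bridge_0 M (h i)" "\<not> bridge_0 M (h (cyc_next p i))"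
    using cyc_next_switch[of k p "\<lambda>i. bridge_0 M (h i)" j] by blast
  moreover from this(1) have "cyc_next p i \<in> {1..2 * p}" by (rule cyc_next_mem)
  ultimately show ?thesis
    using assms(1) that[of "h i" "h (cyc_next p i)"] by (auto simp: pyramidal_ring_def)
qed

section \<open>Consequences of maximality\<close>

lemma finite_stacked_map_if_over:
  "M \<in> stacked_maps_over \<B> \<Omega> \<Longrightarrow> finite_stacked_map M"
  by (auto simp: stacked_maps_over_def finite_stacked_map_def)

text \<open>In a mixed ring some bridge is followed by a non-bridge. Detaching the latter keeps the
  map connected and the bubbles unchanged but increases \<open>Phi_0\<close>. Colored vertices of
  type \<open>nat\<close> guarantee fresh vertices.\<close>

lemma maximal_all_or_no_bridges:
  fixes M :: "('w, nat, 'e) stacked_map"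
  assumes "maximal \<B> \<Omega> M" "pyramidal_ring p M S h"
    and "d \<in> hooks M S" "bridge_0 M d" "d' \<in> hooks M S"
  shows "bridge_0 M d'"
proof (rule ccontr)
  assume "\<not> bridge_0 M d'"
  then obtain a b where ab: "a \<in> hooks M S" "b \<in> hooks M S" "pyramidal M a b"
    "bridge_0 M a" "\<not> bridge_0 M b"
    using pyramidal_ring_switch[OF assms(2-4) assms(5)] by blast
  have over: "M \<in> stacked_maps_over \<B> \<Omega>" using assms(1) by (simp add: maximal_def)
  interpret finite_stacked_map M using over by (rule finite_stacked_map_if_over)
  have f: "finite (cverts M)" using fin by (simp add: finite_map_def)
  obtain x where x: "x \<notin> cverts M" using ex_new_if_finite[OF infinite_UNIV_nat f] by blast
  obtain y where y: "y \<notin> insert x (cverts M)"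
    using ex_new_if_finite[OF infinite_UNIV_nat, of "insert x (cverts M)"] f by blast
  interpret B: detached_edge M y b
    by unfold_locales (use ab(2) y in \<open>auto simp: hooks_def zero_edges_def\<close>)
  have "Suc (Phi_0 M) \<le> Phi_0 (unhook M y b)"
    using finite_stacked_map_axioms ab x y by (intro Phi_0_unhook_next_to_bridge) auto
  moreover have "Phi_0 (unhook M y b) \<le> Phi_0 M"
    using assms(1) B.stacked_maps_over_unhook[OF over ab(5)] B.num_bubbles_unhook
    unfolding maximal_def by blast
  ultimately show False by simp
qed

text \<open>If there were no bridge, detaching \<open>a\<close> would cost at most one face and
  create one, and detaching a non-bridge \<open>b\<close> next to a bridge would win that face back.
  The result \<open>M2\<close> is again maximal, but its ring is mixed, against the
  dichotomy.\<close>

lemma maximal_all_bridges: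
  fixes M :: "('w, nat, 'e) stacked_map"
  assumes "2 < p" "maximal \<B> \<Omega> M" and ring: "pyramidal_ring p M S h" and "d\<^sub>0 \<in> hooks M S"
  shows "bridge_0 M d\<^sub>0"
proof (rule ccontr)
  let ?H = "hooks M S"
  assume "\<not> bridge_0 M d\<^sub>0"
  then have nb: "\<not> bridge_0 M d" if "d \<in> ?H" for d
    using maximal_all_or_no_bridges[OF assms(2) ring that _ assms(4)] by blast
  have H: "finite ?H" "card ?H = 2 * p"
    using ring by (auto simp: pyramidal_ring_def card_image)
  \<comment> \<open>Here \<open>2 < p\<close> enters: up to two edges are excluded, and the counting
    argument then needs more than four edges in the ring.\<close>
  have outside: "\<exists>d \<in> ?H - A. \<exists>d' \<in> ?H - A - {d}. linked M S d' d" if "A \<subseteq> ?H" "card A \<le> 2" for A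
  proof (rule ex_pair_outside[OF H(1) that(1)])
    show "2 * card A < card ?H" using that(2) H(2) assms(1) by simp
    show "\<exists>d' \<in> ?H - {d}. linked M S d' d" if "d \<in> ?H" for d
      using bridge_0_iff[OF that] nb[OF that] by blast
  qed (fact linked_sym linked_trans)+
  have over: "M \<in> stacked_maps_over \<B> \<Omega>" using assms(2) by (simp add: maximal_def)
  interpret finite_stacked_map M using over by (rule finite_stacked_map_if_over)
  have f: "finite (cverts M)" using fin by (simp add: finite_map_def)

  define a where "a = h 1"
  have a: "a \<in> ?H" using ring assms(1) by (auto simp: a_def pyramidal_ring_def)
  have pa: "pyramidal M (h (2 * p)) a"
  proof -
    have "2 * p \<in> {1..2 * p}" "cyc_next p (2 * p) = 1" using assms(1) by (auto simp: cyc_next_def)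
    then show ?thesis using ring unfolding a_def pyramidal_ring_def by metis
  qed
  have ra: "rot M a \<noteq> a" using nb[OF a] bridge_if_free[of a] a by (auto simp: hooks_def)
  obtain x where x: "x \<notin> cverts M" using ex_new_if_finite[OF infinite_UNIV_nat f] by blast
  define M1 where "M1 = unhook M x a"
  interpret A: detached_edge M x a
    rewrites "unhook M x a = M1"
    by (unfold_locales) (use a x in \<open>auto simp: hooks_def zero_edges_def M1_def\<close>)
  have over1: "M1 \<in> stacked_maps_over \<B> \<Omega>" using over nb[OF a] by (rule A.stacked_maps_over_unhook)
  have ring1: "pyramidal_ring p M1 S h" using ring by (rule A.pyramidal_ring_unhook)
  have ba: "bridge_0 M1 a" using A.bridge_unhook_iff[OF a a] by blast
  \<comment> \<open>A pair linked away from \<open>a\<close> remains linked in \<open>M1\<close>, so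
    not all edges have become bridges and the ring of \<open>M1\<close> is mixed.\<close>
  obtain d where d: "d \<in> ?H" "\<not> bridge_0 M1 d"
    using outside[of "{a}"] a A.bridge_unhook_iff[OF a] by auto
  obtain c b where cb: "c \<in> ?H" "b \<in> ?H" "pyramidal M1 c b" "bridge_0 M1 c" "\<not> bridge_0 M1 b"
    using pyramidal_ring_switch[OF ring1, unfolded A.hooks_unhook, OF a ba d] by blast
  have ab: "a \<noteq> b" using ba cb by blast

  have f1: "finite (cverts M1)" using f by (simp add: M1_def)
  \<comment> \<open>\<open>x'\<close> is auxiliary: it is available for the temporary detachment of
    the bridge \<open>c\<close> in the face estimate, whereas \<open>M2\<close> uses only
    \<open>y\<close>.\<close>
  obtain x' where x': "x' \<notin> cverts M1" using ex_new_if_finite[OF infinite_UNIV_nat f1] by blast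
  obtain y where y: "y \<notin> insert x' (cverts M1)"
    using ex_new_if_finite[OF infinite_UNIV_nat, of "insert x' (cverts M1)"] f1 by blast
  have b: "b \<in> edges M1" "ecolor M1 b = 0" "b \<in> hooks M1 S" "c \<in> hooks M1 S" "a \<in> hooks M1 S"
    using cb(1,2) a A.zero_edges_unhook A.hooks_unhook[of S] by (auto simp: hooks_def zero_edges_def)
  define M2 where "M2 = unhook M1 y b"
  interpret B: detached_edge M1 y b
    rewrites "unhook M1 y b = M2"
    by (unfold_locales) (use b y in \<open>auto simp: M2_def\<close>)
  have "Phi_0 M \<le> Suc (Phi_0 M1)" using ra pa by (rule A.Phi_0_unhook_ge)
  also have "\<dots> \<le> Phi_0 M2"
    unfolding M2_def
    by (rule Phi_0_unhook_next_to_bridge[OF A.unhook.finite_stacked_map_axioms b(4,3) cb(3-5) x'])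
      (use y in auto)
  finally have Phi: "Phi_0 M \<le> Phi_0 M2" .
  have over2: "M2 \<in> stacked_maps_over \<B> \<Omega>" using over1 cb(5) by (rule B.stacked_maps_over_unhook)
  have max2: "maximal \<B> \<Omega> M2"
    unfolding maximal_def
  proof (intro conjI over2 allI impI)
    fix N :: "('w, nat, 'e) stacked_map"
    assume "N \<in> stacked_maps_over \<B> \<Omega> \<and>
      (\<forall>B \<in> \<B>. num_bubbles N B (\<Omega> B) = num_bubbles M2 B (\<Omega> B))"
    \<comment> \<open>\<open>M\<close>, \<open>M1\<close> and \<open>M2\<close> have the same bubble
      counts, so a competitor of \<open>M2\<close> is also a competitor of \<open>M\<close>.\<close>
    then have "Phi_0 N \<le> Phi_0 M"
      using assms(2) A.num_bubbles_unhook B.num_bubbles_unhook unfolding maximal_def by metis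
    then show "Phi_0 N \<le> Phi_0 M2" using Phi by simp
  qed
  have ring2: "pyramidal_ring p M2 S h" using ring1 by (rule B.pyramidal_ring_unhook)
  have H2: "hooks M2 S = ?H" by (simp add: A.hooks_unhook B.hooks_unhook)
  have "\<not> linked M1 S d' a" if "d' \<in> ?H - {a}" for d'
    using A.not_linked_unhook[OF a, of d'] that linked_sym[of M1 S d' a]
    by (auto simp: hooks_def zero_edges_def)
  then have "bridge_0 M2 a"
    using B.bridge_unhook_iff[OF b(3,5)] A.hooks_unhook[of S] by auto
  \<comment> \<open>This linked pair avoids both detached edges, so its link persists in
    \<open>M1\<close> and \<open>d\<close> is not a bridge in \<open>M2\<close>.\<close>
  moreover obtain d d' where dd: "d \<in> ?H - {a, b}" "d' \<in> ?H - {a, b} - {d}" "linked M S d' d"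
    using outside[of "{a, b}"] a cb(2) ab by auto
  have "linked M1 S d' d" using dd A.linked_unhook[OF a, of d' d] by simp
  then have "\<not> bridge_0 M2 d"
    using B.bridge_unhook_iff[OF b(3), of d] dd A.hooks_unhook[of S] by auto
  ultimately show False
    using maximal_all_or_no_bridges[OF max2 ring2, unfolded H2, OF a _, of d] dd(1) by blast
qed

section \<open>The pyramidal ring of a copy of the bi-pyramidal bubble\<close>

text \<open>This reconciles two descriptions of a bubble, as an element of the quotient and as the
  class of a given white vertex.\<close>

lemma bubble_at_of_bubble:
  assumes "S \<in> bubbles_of M" "w \<in> wverts M"
  shows "Inl w \<in> S \<longleftrightarrow> bubble_at M w = S"
proof
  obtain v where v: "S = map_joined (delete_0 M) `` {v}"
    using assms(1) by (auto simp: bubbles_of_def components_def elim: quotientE)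
  show "bubble_at M w = S" if "Inl w \<in> S"
    using that unfolding v bubble_at_def by (blast intro: map_joined_sym map_joined_trans)
  show "Inl w \<in> S" if "bubble_at M w = S" using that bubble_at_self[of w M] by simp
qed

section \<open>The permutations of the pairs in the bi-pyramidal bubble\<close>

definition bipyramid_pair :: "nat \<Rightarrow> (nat + nat) set" where
  "bipyramid_pair k = {Inl k, Inr k}"

lemma bipyramid_pairing_eq: "bipyramid_pairing p = bipyramid_pair ` {1..2 * p}"
  by (auto simp: bipyramid_pairing_def bipyramid_pair_def)

lemma bipyramid_pair_inj: "bipyramid_pair k = bipyramid_pair j \<longleftrightarrow> k = j"
  by (auto simp: bipyramid_pair_def doubleton_eq_iff)

lemma bipyramid_bedges_iff:
  "(b, i, w) \<in> bedges (bipyramid p) \<longleftrightarrow> b \<in> black (bipyramid p) \<and> w \<in> white (bipyramid p) \<and>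
     (\<exists>j \<in> {1..2 * p}. i = (if odd j then 1 else 2) \<and>
        ({b, w} = {Inl j, Inl (cyc_next p j)} \<or> {b, w} = {Inr j, Inr (cyc_next p j)}) \<or>
      i = 3 \<and> {b, w} = {Inl j, Inr j})"
  by (simp add: bipyramid_def Let_def)

text \<open>Each pair has one vertex on either cycle, and the two cycles carry the same colors at
  the same indices. Hence an edge can be traced by indices alone, and it may be traversed in either
  direction.\<close>

lemma bipyramid_edge_iff:
  assumes "k \<in> {1..2 * p}" "m \<in> {1..2 * p}"
  shows "(\<exists>b \<in> bipyramid_pair k. \<exists>w \<in> bipyramid_pair m. (b, i, w) \<in> bedges (bipyramid p)) \<longleftrightarrow>
    i = 3 \<and> m = k \<or> (\<exists>j \<in> {1..2 * p}. i = (if odd j then 1 else 2) \<and>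
      (k = j \<and> m = cyc_next p j \<or> m = j \<and> k = cyc_next p j))" (is "?L \<longleftrightarrow> ?R")
proof
  assume ?L
  then obtain b w where bw: "b \<in> bipyramid_pair k" "w \<in> bipyramid_pair m"
    "(b, i, w) \<in> bedges (bipyramid p)" by blast
  then obtain j where j: "j \<in> {1..2 * p}" "i = (if odd j then 1 else 2) \<and>
      ({b, w} = {Inl j, Inl (cyc_next p j)} \<or> {b, w} = {Inr j, Inr (cyc_next p j)}) \<or>
      i = 3 \<and> {b, w} = {Inl j, Inr j}"
    unfolding bipyramid_bedges_iff by blast
  have "{b, w} = {Inl j, Inl n} \<Longrightarrow> k = j \<and> m = n \<or> m = j \<and> k = n"
    "{b, w} = {Inr j, Inr n} \<Longrightarrow> k = j \<and> m = n \<or> m = j \<and> k = n"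
    "{b, w} = {Inl j, Inr j} \<Longrightarrow> m = k" for n
    using bw(1,2) by (auto simp: bipyramid_pair_def doubleton_eq_iff)
  then show ?R using j by metis
next
  assume R: ?R
  \<comment> \<open>This selects the cycle on which the vertex of index \<open>k\<close> is black.
    The white end \<open>?w\<close> is its partner in the pair for color 3, and otherwise the vertex
    of index \<open>m\<close> on the same cycle.\<close>
  let ?c = "\<lambda>n. if odd k then Inl n else Inr n :: nat + nat"
  let ?w = "if i = 3 then if odd k then Inr k else Inl k else ?c m"
  have black: "?c k \<in> black (bipyramid p)" using assms(1) by (simp add: bipyramid_def Let_def)
  have "(?c k, i, ?w) \<in> bedges (bipyramid p)"
  proof (cases "i = 3")
    case True
    have "?w \<in> white (bipyramid p)" using assms(1) True by (simp add: bipyramid_def Let_def)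
    moreover have "{?c k, ?w} = {Inl k, Inr k}" using True by auto
    ultimately show ?thesis using black assms(1) True unfolding bipyramid_bedges_iff by blast
  next
    case False
    then obtain j where j: "j \<in> {1..2 * p}" "i = (if odd j then 1 else 2)"
      "k = j \<and> m = cyc_next p j \<or> m = j \<and> k = cyc_next p j" using R by blast
    then have "odd m \<longleftrightarrow> even k" using cyc_next_parity by auto
    then have "?w \<in> white (bipyramid p)"
      using assms(2) False by (cases "odd k") (simp_all add: bipyramid_def Let_def)
    moreover have "{?c k, ?w} = {Inl j, Inl (cyc_next p j)} \<or>
      {?c k, ?w} = {Inr j, Inr (cyc_next p j)}"
      using j(3) False by auto
    ultimately show ?thesis using black j(1,2) unfolding bipyramid_bedges_iff by blast
  qed
  moreover have "?c k \<in> bipyramid_pair k" "?w \<in> bipyramid_pair m"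
    using R by (auto simp: bipyramid_pair_def split: if_splits)
  ultimately show ?L by blast
qed

lemma pair_perm_bipyramidI:
  assumes "k \<in> {1..2 * p}" "j \<in> {1..2 * p}"
    and "\<And>m. m \<in> {1..2 * p} \<Longrightarrow>
      (\<exists>b \<in> bipyramid_pair k. \<exists>w \<in> bipyramid_pair m. (b, i, w) \<in> bedges (bipyramid p)) \<longleftrightarrow> m = j"
  shows "pair_perm (bipyramid p) (bipyramid_pairing p) i (bipyramid_pair k) = bipyramid_pair j"
  unfolding pair_perm_def bipyramid_pairing_eq
proof (rule the_equality)
  show "bipyramid_pair j \<in> bipyramid_pair ` {1..2 * p} \<and>
    (\<exists>b \<in> bipyramid_pair k. \<exists>w \<in> bipyramid_pair j. (b, i, w) \<in> bedges (bipyramid p))"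
    using assms by blast
  fix \<pi>'
  assume "\<pi>' \<in> bipyramid_pair ` {1..2 * p} \<and>
    (\<exists>b \<in> bipyramid_pair k. \<exists>w \<in> \<pi>'. (b, i, w) \<in> bedges (bipyramid p))"
  then show "\<pi>' = bipyramid_pair j" using assms(3) by blast
qed

text \<open>Fixed points of color 3 become leaves of the stacked map, and the exchange of
  \<open>k\<close> with \<open>cyc_next p k\<close> becomes a bivalent vertex of color 1 or
  2.\<close>

lemma pair_perm_bipyramid:
  assumes k: "k \<in> {1..2 * p}"
  shows "pair_perm (bipyramid p) (bipyramid_pairing p) 3 (bipyramid_pair k) = bipyramid_pair k"
    and "i = (if odd k then 1 else 2) \<Longrightarrow>
      pair_perm (bipyramid p) (bipyramid_pairing p) i (bipyramid_pair k) =
        bipyramid_pair (cyc_next p k)"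
    and "i = (if odd k then 1 else 2) \<Longrightarrow>
      pair_perm (bipyramid p) (bipyramid_pairing p) i (bipyramid_pair (cyc_next p k)) =
        bipyramid_pair k"
proof -
  note n = cyc_next_mem[OF k]
  show "pair_perm (bipyramid p) (bipyramid_pairing p) 3 (bipyramid_pair k) = bipyramid_pair k"
    by (rule pair_perm_bipyramidI[OF k k]) (use k bipyramid_edge_iff in auto)
  assume i: "i = (if odd k then 1 else 2)"
  \<comment> \<open>The color determines the parity of the index where an edge starts, while
    \<open>cyc_next\<close> flips parity. This excludes the other cycle edge at an index.\<close>
  have par: "odd j \<longleftrightarrow> odd k" if "i = (if odd j then 1 else 2)" for j :: nat
    using that i by (cases "odd j"; cases "odd k") simp_all
  have i3: "i \<noteq> 3" using i by simp
  show "pair_perm (bipyramid p) (bipyramid_pairing p) i (bipyramid_pair k) =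
        bipyramid_pair (cyc_next p k)"
  proof (rule pair_perm_bipyramidI[OF k n])
    fix m assume m: "m \<in> {1..2 * p}"
    have "m = cyc_next p k" if "i = (if odd j then 1 else 2)"
      "k = j \<and> m = cyc_next p j \<or> m = j \<and> k = cyc_next p j" for j
      using par[OF that(1)] that(2) cyc_next_parity[of p j] by blast
    then show "(\<exists>b \<in> bipyramid_pair k. \<exists>w \<in> bipyramid_pair m. (b, i, w) \<in> bedges (bipyramid p)) \<longleftrightarrow>
      m = cyc_next p k"
      unfolding bipyramid_edge_iff[OF k m] using i i3 k by blast
  qed
  show "pair_perm (bipyramid p) (bipyramid_pairing p) i (bipyramid_pair (cyc_next p k)) =
        bipyramid_pair k"
  proof (rule pair_perm_bipyramidI[OF n k])
    fix m assume m: "m \<in> {1..2 * p}"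
    have "m = k" if "j \<in> {1..2 * p}" "i = (if odd j then 1 else 2)"
      "cyc_next p k = j \<and> m = cyc_next p j \<or> m = j \<and> cyc_next p k = cyc_next p j" for j
      using par[OF that(2)] that(1,3) cyc_next_parity[of p k] cyc_next_inj[OF k, of j] by blast
    then show "(\<exists>b \<in> bipyramid_pair (cyc_next p k). \<exists>w \<in> bipyramid_pair m.
        (b, i, w) \<in> bedges (bipyramid p)) \<longleftrightarrow> m = k"
      unfolding bipyramid_edge_iff[OF n m] using i i3 k by blast
  qed
qed

text \<open>Coordinates on the copy, pulled back through the isomorphism: \<open>w k\<close> is the
  white vertex of the \<open>k\<close>-th pair and \<open>\<epsilon> i k\<close> is its edge of
  color \<open>i\<close>.\<close>

lemma (in finite_stacked_map) copy_bipyramid_edges: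
  assumes S: "S \<in> bubbles_of M" and "is_copy M S (bipyramid p) (bipyramid_pairing p)"
  obtains w \<epsilon> where "bij_betw w {1..2 * p} {v \<in> wverts M. Inl v \<in> S}"
    "\<And>k i. k \<in> {1..2 * p} \<Longrightarrow> i \<in> {1, 2, 3} \<Longrightarrow>
       \<epsilon> i k \<in> edges M \<and> ecolor M (\<epsilon> i k) = i \<and> wend M (\<epsilon> i k) = w k"
    "\<And>k j i. k \<in> {1..2 * p} \<Longrightarrow> j \<in> {1..2 * p} \<Longrightarrow> i \<in> {1, 2, 3} \<Longrightarrow>
       pair_perm (bipyramid p) (bipyramid_pairing p) i (bipyramid_pair k) = bipyramid_pair j \<Longrightarrow>
       rot M (\<epsilon> i k) = \<epsilon> i j"
proof -
  let ?N = "induced_map (delete_0 M) S" and ?P = "Psi (bipyramid p) (bipyramid_pairing p)"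
  let ?K = "{1..2 * p}"
  obtain f g h where f: "bij_betw f (wverts ?N) (wverts ?P)" and h: "bij_betw h (edges ?N) (edges ?P)"
    and g: "\<And>y. y \<in> cverts ?N \<Longrightarrow> vcolor ?P (g y) = vcolor ?N y"
    and *: "\<And>d. d \<in> edges ?N \<Longrightarrow> wend ?P (h d) = f (wend ?N d) \<and> cend ?P (h d) = g (cend ?N d) \<and>
        rot ?P (h d) = h (rot ?N d)"
    using assms(2) unfolding is_copy_def isomorphic_def by blast
  have wN: "wverts ?N = {v \<in> wverts M. Inl v \<in> S}" by (simp add: induced_map_def delete_0_def)
  have eN: "edges ?N = {d \<in> edges M. ecolor M d \<noteq> 0 \<and> Inl (wend M d) \<in> S \<and> Inr (cend M d) \<in> S}"
    by (auto simp: induced_map_def delete_0_def)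
  have sN [simp]: "wend ?N = wend M" "cend ?N = cend M" "rot ?N = rot M" "vcolor ?N = vcolor M"
    by (simp_all add: induced_map_def delete_0_def)
  have wP: "wverts ?P = bipyramid_pair ` ?K" and eP: "edges ?P = bipyramid_pair ` ?K \<times> {1, 2, 3}"
    by (simp_all add: Psi_def bipyramid_pairing_eq)
  have pair: "bij_betw bipyramid_pair ?K (wverts ?P)"
    unfolding wP by (intro inj_on_imp_bij_betw inj_onI) (simp add: bipyramid_pair_inj)
  define w where "w = inv_into (wverts ?N) f \<circ> bipyramid_pair"
  have w: "bij_betw w ?K (wverts ?N)"
    unfolding w_def using pair bij_betw_inv_into[OF f] by (rule bij_betw_trans)
  have fw: "f (w k) = bipyramid_pair k" if "k \<in> ?K" for k
    using that f wP unfolding w_def by (simp add: bij_betw_def f_inv_into_f)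
  define \<epsilon> where "\<epsilon> i k = inv_into (edges ?N) h (bipyramid_pair k, i)" for i k
  have mem: "\<epsilon> i k \<in> edges ?N" and h\<epsilon>: "h (\<epsilon> i k) = (bipyramid_pair k, i)"
    if "k \<in> ?K" "i \<in> {1, 2, 3}" for i k
    using that h eP unfolding \<epsilon>_def by (auto simp: bij_betw_def intro!: inv_into_into f_inv_into_f)
  show thesis
  proof (rule that)
    show "bij_betw w ?K {v \<in> wverts M. Inl v \<in> S}" using w wN by simp
  next
    fix k i assume k: "k \<in> ?K" and i: "i \<in> {1, 2, 3 :: nat}"
    note m = mem[OF k i]
    have d: "\<epsilon> i k \<in> edges M" "Inl (wend M (\<epsilon> i k)) \<in> S" "Inr (cend M (\<epsilon> i k)) \<in> S"
      "ecolor M (\<epsilon> i k) \<noteq> 0"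
      using m unfolding eN by auto
    have "f (wend M (\<epsilon> i k)) = f (w k)" using *[OF m] h\<epsilon>[OF k i] fw[OF k] by (simp add: Psi_def)
    moreover have "wend M (\<epsilon> i k) \<in> wverts ?N" using d endpoints(1)[OF d(1)] wN by simp
    moreover have "w k \<in> wverts ?N" using w k by (auto simp: bij_betw_def)
    ultimately have "wend M (\<epsilon> i k) = w k" using f by (auto simp: bij_betw_def dest: inj_onD)
    moreover have "cend M (\<epsilon> i k) \<in> cverts ?N"
      using d endpoints(2)[OF d(1)] by (auto simp: induced_map_def delete_0_def ecolor_def)
    then have "ecolor M (\<epsilon> i k) = vcolor ?P (cend ?P (h (\<epsilon> i k)))"
      using g[of "cend M (\<epsilon> i k)"] *[OF m] by (simp add: ecolor_def)
    then have "ecolor M (\<epsilon> i k) = i" unfolding h\<epsilon>[OF k i] by (simp add: Psi_def)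
    ultimately show "\<epsilon> i k \<in> edges M \<and> ecolor M (\<epsilon> i k) = i \<and> wend M (\<epsilon> i k) = w k" using d by simp
  next
    fix k j i assume k: "k \<in> ?K" and j: "j \<in> ?K" and i: "i \<in> {1, 2, 3 :: nat}"
      and pp: "pair_perm (bipyramid p) (bipyramid_pairing p) i (bipyramid_pair k) = bipyramid_pair j"
    note m = mem[OF k i]
    have d: "\<epsilon> i k \<in> edges M" "Inl (wend M (\<epsilon> i k)) \<in> S" "Inr (cend M (\<epsilon> i k)) \<in> S"
      "ecolor M (\<epsilon> i k) \<noteq> 0"
      using m unfolding eN by auto
    \<comment> \<open>The bijection \<open>h\<close> is injective only on the edges of the copy, so
      the rotated edge must first be seen to stay in the bubble.\<close>
    have "bubble_at M (wend M (rot M (\<epsilon> i k))) = S"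
      using bubble_at_rot[OF d(1,4)] bubble_at_of_bubble[OF S endpoints(1)[OF d(1)]] d(2) by simp
    then have "Inl (wend M (rot M (\<epsilon> i k))) \<in> S"
      using bubble_at_self[of "wend M (rot M (\<epsilon> i k))" M] by simp
    then have "rot M (\<epsilon> i k) \<in> edges ?N" using d rot_closed[OF d(1)] unfolding eN by simp
    moreover have "h (rot M (\<epsilon> i k)) = h (\<epsilon> i j)"
      using *[OF m] h\<epsilon>[OF k i] h\<epsilon>[OF j i] pp by (simp add: Psi_def)
    ultimately show "rot M (\<epsilon> i k) = \<epsilon> i j"
      using h mem[OF j i] by (auto simp: bij_betw_def dest: inj_onD)
  qed
qed

text \<open>Each white vertex has exactly one color-0 edge, so listing these edges along
  \<open>w\<close> exhausts the color-0 edges at \<open>S\<close> without repetition.\<close>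

lemma (in finite_stacked_map) copy_bipyramid_ring:
  assumes S: "S \<in> bubbles_of M" and "is_copy M S (bipyramid p) (bipyramid_pairing p)"
  obtains h where "pyramidal_ring p M S h"
proof (rule copy_bipyramid_edges[OF assms])
  let ?K = "{1..2 * p}"
  fix w \<epsilon>
  assume w: "bij_betw w ?K {v \<in> wverts M. Inl v \<in> S}"
    and \<epsilon>: "\<And>k i. k \<in> ?K \<Longrightarrow> i \<in> {1, 2, 3} \<Longrightarrow>
       \<epsilon> i k \<in> edges M \<and> ecolor M (\<epsilon> i k) = i \<and> wend M (\<epsilon> i k) = w k"
    and r: "\<And>k j i. k \<in> ?K \<Longrightarrow> j \<in> ?K \<Longrightarrow> i \<in> {1, 2, 3} \<Longrightarrow>
       pair_perm (bipyramid p) (bipyramid_pairing p) i (bipyramid_pair k) = bipyramid_pair j \<Longrightarrow>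
       rot M (\<epsilon> i k) = \<epsilon> i j"
  have wK: "w k \<in> wverts M" "Inl (w k) \<in> S" if "k \<in> ?K" for k
    using w that by (auto simp: bij_betw_def)
  have "\<forall>k \<in> ?K. \<exists>d. d \<in> edges M \<and> wend M d = w k \<and> ecolor M d = 0"
    using edge_exists[OF wK(1), of _ 0] by blast
  then obtain h where h: "\<And>k. k \<in> ?K \<Longrightarrow> h k \<in> edges M \<and> wend M (h k) = w k \<and> ecolor M (h k) = 0"
    by metis
  have "hooks M S = h ` ?K"
  proof (intro set_eqI iffI)
    fix d assume d: "d \<in> hooks M S"
    then have de: "d \<in> edges M" "ecolor M d = 0" "bubble_at M (wend M d) = S"
      by (auto simp: hooks_def zero_edges_def)
    then have "wend M d \<in> {v \<in> wverts M. Inl v \<in> S}"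
      using bubble_at_of_bubble[OF S] endpoints(1) by auto
    then have "wend M d \<in> w ` ?K" using w by (simp add: bij_betw_def)
    then obtain k where k: "k \<in> ?K" "wend M d = w k" by blast
    then have "d = h k" using h[OF k(1)] de by (intro edge_unique) auto
    then show "d \<in> h ` ?K" using k by blast
  next
    fix d assume "d \<in> h ` ?K"
    then obtain k where k: "k \<in> ?K" "d = h k" by blast
    then show "d \<in> hooks M S"
      using h[OF k(1)] wK[OF k(1)] bubble_at_of_bubble[OF S] by (simp add: hooks_def zero_edges_def)
  qed
  moreover have "inj_on h ?K"
    using w h by (metis (no_types, lifting) bij_betw_def inj_on_def)
  moreover have "pyramidal M (h k) (h (cyc_next p k))" if k: "k \<in> ?K" for k
  proof -
    let ?n = "cyc_next p k"
    note n = cyc_next_mem[OF k]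
    \<comment> \<open>The color of both cycle edges joining the indices \<open>k\<close> and
      \<open>?n\<close>.\<close>
    define i :: nat where "i = (if odd k then 1 else 2)"
    have i: "i \<in> {1, 2, 3}" by (simp add: i_def)
    have "rot M (\<epsilon> 3 ?n) = \<epsilon> 3 ?n" using r[OF n n] pair_perm_bipyramid(1)[OF n] by simp
    moreover have "rot M (\<epsilon> i k) = \<epsilon> i ?n" using r[OF k n i] pair_perm_bipyramid(2)[OF k i_def] by simp
    moreover have "rot M (\<epsilon> i ?n) = \<epsilon> i k" using r[OF n k i] pair_perm_bipyramid(3)[OF k i_def] by simp
    moreover have "i \<in> {1, 2}" by (simp add: i_def)
    ultimately show ?thesis
      unfolding pyramidal_def using \<epsilon>[OF n, of 3] \<epsilon>[OF n i] \<epsilon>[OF k i] h[OF k] h[OF n]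
      by (intro bexI[of _ "\<epsilon> 3 ?n"] bexI[of _ "\<epsilon> i ?n"] bexI[of _ "\<epsilon> i k"]) auto
  qed
  ultimately have "pyramidal_ring p M S h" by (simp add: pyramidal_ring_def)
  then show thesis by (rule that)
qed

theorem corollary3p3p1:
  fixes p :: nat
  assumes "p > 2"
  shows "cut_bubble_property (bipyramid p) (bipyramid_pairing p)"
  unfolding cut_bubble_property_def
proof (intro allI impI ballI)
  fix \<B> \<Omega> and M :: "(nat, nat, nat) stacked_map" and S
  assume *: "bipyramid p \<in> \<B> \<and> (\<forall>B\<in>\<B>. is_bubble B \<and> is_pairing B (\<Omega> B)) \<and>
       \<Omega> (bipyramid p) = bipyramid_pairing p \<and> maximal \<B> \<Omega> M"
    and S: "S \<in> bubbles_of M" "is_copy M S (bipyramid p) (bipyramid_pairing p)"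
  then interpret finite_stacked_map M
    by (intro finite_stacked_map_if_over) (auto simp: maximal_def)
  obtain h where "pyramidal_ring p M S h" using copy_bipyramid_ring[OF S] .
  then have "bridge_0 M d" if "d \<in> hooks M S" for d
    using maximal_all_bridges[OF assms _ _ that] * by blast
  then show "cut_bubble M S"
    using bubble_at_of_bubble[OF S(1)] endpoints(1)
    by (auto simp: cut_bubble_def hooks_def zero_edges_def)
qed

end
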